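(* Let $\Omega$ be a domain with a positive measure $\mu$, let $2\le s<\infty$, and let $\Phi$ be a Young function satisfying the $\nabla_2$ condition and such that $u\mapsto\Phi(u^{1/s})$ is concave on $[0,\infty)$. Then there exist constants $A,m>0$ and a Young function $\widetilde\Phi$ with $A^{-1}\Phi(u)\le\widetilde\Phi(u)\le A\Phi(u)$ for all $u\ge0$, such that $$\max\big\{\|f+g\|_{O(\widetilde\Phi)},\|f-g\|_{O(\widetilde\Phi)}\big\}\ge\big(\|f\|_{O(\widetilde\Phi)}^s+m\|g\|_{O(\widetilde\Phi)}^s\big)^{1/s}\quad\text{for all } f,g\in\mathcal{M}(\Phi).$$
   Context: A Young function is an increasing convex function $\Phi$ on $\mathbb{R}_+=[0,\infty)$ with $\Phi(0)=0$. The Orlicz class is $\mathcal{M}(\Phi)=\{f:\int_\Omega\Phi(|f(x)|)\,d\mu(x)<\infty\}$. For a Young function $\Phi$ with $\lim_{x\to\infty}\Phi(x)/x=\infty$, the complementary Young function is $\Psi(y)=\sup\{xy-\Phi(x):x\ge0\}$, $y\ge0$. The Orlicz norm is $$\|f\|_{O(\Phi)}=\sup\Big\{\int_\Omega|f(x)g(x)|\,d\mu(x):\int_\Omega\Psi(|g(x)|)\,d\mu(x)\le1\Big\},$$ where $\Psi$ is the Young function complementary to $\Phi$. A Young function $\Phi$ satisfies the $\nabla_2$ condition if for some $a>1$ one has $\Phi(x)\le\frac1{2a}\Phi(ax)$ for all $x\ge x_0$, for some $x_0\ge0$, where $x_0=0$ is required when $\mu(\Omega)=\infty$. *)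

theory Defs
  imports "HOL-Analysis.Analysis"
begin

text \<open>Young functions are represented by total functions \<open>\<Phi> :: real \<Rightarrow> real\<close>, of which only the
  values on \<open>[0,\<infinity>)\<close> matter. ``Increasing'' is read as nondecreasing; for a nonzero \<open>\<Phi>\<close>
  such that \<open>\<Phi>(u\<^sup>1\<^sup>/\<^sup>s)\<close> is concave, strict monotonicity is automatic.\<close>

definition young_function :: "(real \<Rightarrow> real) \<Rightarrow> bool" where
  "young_function \<Phi> \<longleftrightarrow> mono_on {0..} \<Phi> \<and> convex_on {0..} \<Phi> \<and> \<Phi> 0 = 0"

text \<open>Extended values keep the supremum meaningful when it is infinite. The map \<open>ennreal\<close>
  truncates negative reals to \<open>0\<close>, which leaves the supremum unchanged because
  \<open>x = 0\<close> contributes \<open>-\<Phi> 0 = 0\<close>.\<close>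

definition complementary :: "(real \<Rightarrow> real) \<Rightarrow> real \<Rightarrow> ennreal" where
  "complementary \<Phi> y = (SUP x\<in>{0..}. ennreal (x * y - \<Phi> x))"

text \<open>Functions are complex-valued. This includes the real-valued ones: everything below
  depends on a function, and on the test functions, only through absolute values.\<close>

definition orlicz_class :: "'a measure \<Rightarrow> (real \<Rightarrow> real) \<Rightarrow> ('a \<Rightarrow> complex) set" where
  "orlicz_class M \<Phi> = {f \<in> borel_measurable M. (\<integral>\<^sup>+x. ennreal (\<Phi> (cmod (f x))) \<partial>M) < \<infinity>}"

definition orlicz_ennorm :: "'a measure \<Rightarrow> (real \<Rightarrow> real) \<Rightarrow> ('a \<Rightarrow> complex) \<Rightarrow> ennreal" where
  "orlicz_ennorm M \<Phi> f =
     (SUP g\<in>{g \<in> borel_measurable M. (\<integral>\<^sup>+x. complementary \<Phi> (cmod (g x)) \<partial>M) \<le> 1}.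
        \<integral>\<^sup>+x. ennreal (cmod (f x * g x)) \<partial>M)"

text \<open>The conversion to a real number sends \<open>\<infinity>\<close> to \<open>0\<close>; the lemmas at the end of this theory
  show that no infinite value occurs on an Orlicz class, nor for sums and differences
  of its members.\<close>

definition orlicz_norm :: "'a measure \<Rightarrow> (real \<Rightarrow> real) \<Rightarrow> ('a \<Rightarrow> complex) \<Rightarrow> real" where
  "orlicz_norm M \<Phi> f = enn2real (orlicz_ennorm M \<Phi> f)"

definition nabla2 :: "'a measure \<Rightarrow> (real \<Rightarrow> real) \<Rightarrow> bool" where
  "nabla2 M \<Phi> \<longleftrightarrow>
     (\<exists>a>1. \<exists>x0\<ge>0. (emeasure M (space M) = \<infinity> \<longrightarrow> x0 = 0) \<and>
        (\<forall>x\<ge>x0. \<Phi> x \<le> 1 / (2 * a) * \<Phi> (a * x)))"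

lemma young_inequality:
  assumes "young_function \<Phi>" "0 \<le> x"
  shows "ennreal (x * y) \<le> ennreal (\<Phi> x) + complementary \<Phi> y"
proof -
  have "\<Phi> 0 \<le> \<Phi> x"
    using assms mono_onD[of "{0..}" \<Phi> 0 x] by (simp add: young_function_def)
  then have nn: "0 \<le> \<Phi> x"
    using assms(1) by (simp add: young_function_def)
  have "ennreal (x * y) \<le> ennreal (\<Phi> x + max 0 (x * y - \<Phi> x))"
    by (intro ennreal_leI) auto
  also have "\<dots> = ennreal (\<Phi> x) + ennreal (max 0 (x * y - \<Phi> x))"
    using nn by (intro ennreal_plus) auto
  also have "ennreal (max 0 (x * y - \<Phi> x)) = ennreal (x * y - \<Phi> x)"
    by (simp add: max_def ennreal_neg)
  also have "\<dots> \<le> complementary \<Phi> y"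
    unfolding complementary_def using assms(2) by (intro SUP_upper) auto
  finally show ?thesis by (simp add: add_left_mono)
qed

lemma orlicz_ennorm_finite:
  assumes Y: "young_function \<Phi>" "young_function \<Phi>'"
    and dom: "\<And>u. 0 \<le> u \<Longrightarrow> \<Phi>' u \<le> A * \<Phi> u" "0 \<le> A"
    and f: "f \<in> orlicz_class M \<Phi>"
  shows "orlicz_ennorm M \<Phi>' f < \<infinity>"
proof -
  define I where "I = (\<integral>\<^sup>+x. ennreal (\<Phi> (cmod (f x))) \<partial>M)"
  have fm[measurable]: "f \<in> borel_measurable M" and I: "I < \<infinity>"
    using f by (auto simp: orlicz_class_def I_def)
  have meas: "(\<lambda>x. ennreal (\<Phi> (cmod (f x)))) \<in> borel_measurable M"
  proof -
    define \<Phi>0 where "\<Phi>0 u = \<Phi> (max 0 u)" for u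
    have "mono \<Phi>0"
      using Y(1) mono_onD[of "{0..}" \<Phi>]
      by (intro monoI) (simp add: young_function_def \<Phi>0_def)
    then have [measurable]: "\<Phi>0 \<in> borel_measurable borel"
      by (rule borel_measurable_mono)
    have "(\<lambda>x. ennreal (\<Phi>0 (cmod (f x)))) \<in> borel_measurable M" by measurable
    then show ?thesis by (simp add: \<Phi>0_def)
  qed
  have "(\<integral>\<^sup>+x. ennreal (cmod (f x * g x)) \<partial>M) \<le> ennreal A * I + 1"
    if g[measurable]: "g \<in> borel_measurable M"
      and g1: "(\<integral>\<^sup>+x. complementary \<Phi>' (cmod (g x)) \<partial>M) \<le> 1" for g
  proof -
    have "(\<integral>\<^sup>+x. ennreal (cmod (f x * g x)) \<partial>M)
        \<le> (\<integral>\<^sup>+x. ennreal A * ennreal (\<Phi> (cmod (f x))) + complementary \<Phi>' (cmod (g x)) \<partial>M)"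
    proof (rule nn_integral_mono)
      fix x
      have "ennreal (cmod (f x * g x)) \<le> ennreal (\<Phi>' (cmod (f x))) + complementary \<Phi>' (cmod (g x))"
        unfolding norm_mult by (rule young_inequality[OF Y(2)]) simp
      also have "ennreal (\<Phi>' (cmod (f x))) \<le> ennreal A * ennreal (\<Phi> (cmod (f x)))"
        using dom by (simp flip: ennreal_mult' add: ennreal_leI)
      finally show "ennreal (cmod (f x * g x))
          \<le> ennreal A * ennreal (\<Phi> (cmod (f x))) + complementary \<Phi>' (cmod (g x))"
        by (simp add: add_right_mono)
    qed
    also have "\<dots> = ennreal A * I + (\<integral>\<^sup>+x. complementary \<Phi>' (cmod (g x)) \<partial>M)"
    proof -
      have [measurable]: "complementary \<Phi>' \<in> borel_measurable borel"
      proof (rule borel_measurableI_greater)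
        fix t
        have "open (\<Union>x\<in>{0..}. {y. t < ennreal (x * y - \<Phi>' x)})"
          by (intro open_UN ballI open_Collect_less continuous_on_ennreal continuous_intros)
        also have "(\<Union>x\<in>{0..}. {y. t < ennreal (x * y - \<Phi>' x)}) = {y. t < complementary \<Phi>' y}"
          by (auto simp: complementary_def less_SUP_iff)
        finally show "{y \<in> space borel. t < complementary \<Phi>' y} \<in> sets borel"
          by simp
      qed
      have "(\<lambda>x. complementary \<Phi>' (cmod (g x))) \<in> borel_measurable M" by measurable
      then show ?thesis
        using meas by (simp add: nn_integral_add nn_integral_cmult I_def)
    qed
    also have "\<dots> \<le> ennreal A * I + 1" using g1 by (rule add_left_mono)
    finally show ?thesis .
  qed
  then have "orlicz_ennorm M \<Phi>' f \<le> ennreal A * I + 1"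
    unfolding orlicz_ennorm_def by (auto intro: SUP_least)
  also have "\<dots> < \<infinity>"
    using I by (simp add: ennreal_mult_less_top)
  finally show ?thesis .
qed

lemma orlicz_ennorm_add_le:
  assumes [measurable]: "f \<in> borel_measurable M" "g \<in> borel_measurable M"
  shows "orlicz_ennorm M \<Phi> (\<lambda>x. f x + g x) \<le> orlicz_ennorm M \<Phi> f + orlicz_ennorm M \<Phi> g"
    and "orlicz_ennorm M \<Phi> (\<lambda>x. f x - g x) \<le> orlicz_ennorm M \<Phi> f + orlicz_ennorm M \<Phi> g"
proof -
  have key: "orlicz_ennorm M \<Phi> k \<le> orlicz_ennorm M \<Phi> f + orlicz_ennorm M \<Phi> g"
    if k: "\<And>x. cmod (k x) \<le> cmod (f x) + cmod (g x)" for k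
    unfolding orlicz_ennorm_def[of M \<Phi> k]
  proof (rule SUP_least)
    fix h assume h: "h \<in> {g \<in> borel_measurable M. (\<integral>\<^sup>+x. complementary \<Phi> (cmod (g x)) \<partial>M) \<le> 1}"
    then have [measurable]: "h \<in> borel_measurable M" by simp
    have "(\<integral>\<^sup>+x. ennreal (cmod (k x * h x)) \<partial>M)
        \<le> (\<integral>\<^sup>+x. ennreal (cmod (f x * h x)) + ennreal (cmod (g x * h x)) \<partial>M)"
    proof (rule nn_integral_mono)
      fix x
      have "cmod (k x) * cmod (h x) \<le> (cmod (f x) + cmod (g x)) * cmod (h x)"
        by (intro mult_right_mono k) simp
      then show "ennreal (cmod (k x * h x)) \<le> ennreal (cmod (f x * h x)) + ennreal (cmod (g x * h x))"
        by (simp add: norm_mult distrib_right ennreal_leI flip: ennreal_plus)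
    qed
    also have "\<dots> = (\<integral>\<^sup>+x. ennreal (cmod (f x * h x)) \<partial>M) + (\<integral>\<^sup>+x. ennreal (cmod (g x * h x)) \<partial>M)"
      by (intro nn_integral_add) measurable
    also have "\<dots> \<le> orlicz_ennorm M \<Phi> f + orlicz_ennorm M \<Phi> g"
      unfolding orlicz_ennorm_def using h by (intro add_mono SUP_upper)
    finally show "(\<integral>\<^sup>+x. ennreal (cmod (k x * h x)) \<partial>M) \<le> orlicz_ennorm M \<Phi> f + orlicz_ennorm M \<Phi> g" .
  qed
  show "orlicz_ennorm M \<Phi> (\<lambda>x. f x + g x) \<le> orlicz_ennorm M \<Phi> f + orlicz_ennorm M \<Phi> g"
    by (rule key) (rule norm_triangle_ineq)
  show "orlicz_ennorm M \<Phi> (\<lambda>x. f x - g x) \<le> orlicz_ennorm M \<Phi> f + orlicz_ennorm M \<Phi> g"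
    by (rule key) (rule norm_triangle_ineq4)
qed

end

theory Submission
  imports Defs
begin

text \<open>
  The Orlicz norm is a supremum of pairings with functions of modular at most \<open>1\<close>, the modular
  being the integral of the complementary function \<open>\<Psi>\<close>. Convexity of power type \<open>s\<close> of such a
  norm therefore follows, by duality, from smoothness of power type \<open>\<sigma> = s / (s - 1)\<close> of the modular.

  Two scaling properties of a function \<open>\<phi>\<close> make its conjugate \<open>\<psi>\<close> smooth. If \<open>\<phi>\<close> is a convex
  function of \<open>x\<^sup>p\<close> with \<open>p > 1\<close>, then \<open>\<psi>\<close> is a concave function of \<open>y\<^sup>q\<close>, where \<open>q\<close> is the exponent
  dual to \<open>p\<close>, because \<open>u\<^sup>1\<^sup>/\<^sup>p v\<^sup>1\<^sup>/\<^sup>q\<close> is jointly concave; hence \<open>\<psi>(|c + D|)\<close> exceeds \<open>\<psi>(|c|)\<close> on average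
  over centred perturbations \<open>D\<close> with \<open>|D| \<le> |c|\<close> by at most a multiple of \<open>(|D| / |c|)\<^sup>2 \<psi>(|c|)\<close>. If
  \<open>\<phi>(l x) \<ge> l\<^sup>s \<phi>(x)\<close> for \<open>l \<le> 1\<close>, then \<open>\<psi>(l y) \<le> l\<^sup>\<sigma> \<psi>(y)\<close>, which for \<open>D = \<tau> d\<close> turns this excess into
  a multiple of \<open>\<tau>\<^sup>\<sigma> (\<psi>(|c|) + \<psi>(|d|))\<close> (\<open>conjugate_smooth\<close>).

  The given \<open>\<Phi>\<close> has the second property by concavity of \<open>\<Phi>(u\<^sup>1\<^sup>/\<^sup>s)\<close>. By \<open>\<nabla>\<^sub>2\<close> it has the first one up
  to constants, but only beyond some \<open>x\<^sub>0\<close>. Near \<open>0\<close> it may be linear, and then no function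
  equivalent to it has the first property. So one constructs \<open>\<phi>\<close> with both properties that is dominated by \<open>\<Phi>\<close> everywhere and
  comparable to it for large arguments (\<open>power_hull_properties\<close>), and takes \<open>\<Phi> + \<phi>\<close> as the equivalent
  Young function. Its conjugate \<open>\<Psi>\<close> inherits the smoothness of \<open>\<psi>\<close> since it is an infimal convolution of
  \<open>\<psi>\<close> with the conjugate of \<open>\<Phi>\<close>: at every point some translate of \<open>\<psi>\<close>, shifted by a constant, touches \<open>\<Psi>\<close> from above
  (\<open>conjugate_add_touching\<close>). Finally \<open>\<psi>\<close> is bounded by a multiple of \<open>\<Psi> + K\<close>, where \<open>K\<close> has finite
  integral, as \<open>K = 0\<close> when \<open>\<mu>(\<Omega>) = \<infinity>\<close>.

  Integrating, test functions \<open>h\<^sub>1 \<plusminus> \<tau> h\<^sub>2\<close> built from admissible \<open>h\<^sub>1\<close>, \<open>h\<^sub>2\<close> become admissible after division by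
  numbers whose average is at most \<open>1 + O(\<tau>\<^sup>\<sigma>)\<close>. Pairing them with \<open>f \<plusminus> g\<close> gives
  \<open>\<parallel>f\<parallel> + \<tau> \<parallel>g\<parallel> \<le> N (1 + O(\<tau>\<^sup>\<sigma>))\<close> for \<open>N = max \<parallel>f \<plusminus> g\<parallel>\<close> and all small \<open>\<tau>\<close>
  (\<open>weak_norm_inequality\<close>), and optimising over \<open>\<tau>\<close> yields the power type inequality.
\<close>

section \<open>Conjugate functions\<close>

lemma young_nonneg: "0 \<le> \<Phi> x" if "young_function \<Phi>" "0 \<le> x"
  using that unfolding young_function_def mono_on_def by (metis atLeast_iff order_refl)

lemma young_mono: "\<Phi> x \<le> \<Phi> y" if "young_function \<Phi>" "0 \<le> x" "x \<le> y"
  using that unfolding young_function_def mono_on_def by force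

text \<open>The real-valued counterpart of \<open>complementary\<close>, on which one can compute; it is meaningful only for
  superlinear functions, where the supremum is finite.\<close>

definition conjugate :: "(real \<Rightarrow> real) \<Rightarrow> real \<Rightarrow> real" where
  "conjugate \<phi> y = (SUP x\<in>{0..}. x * y - \<phi> x)"

text \<open>Finiteness of the conjugate, which for convex functions amounts to \<open>\<phi>(x) / x \<rightarrow> \<infinity>\<close>.\<close>

definition superlinear :: "(real \<Rightarrow> real) \<Rightarrow> bool" where
  "superlinear \<phi> \<longleftrightarrow> (\<forall>y. bdd_above ((\<lambda>x. x * y - \<phi> x) ` {0..}))"

lemma superlinear_mono:
  assumes "superlinear \<phi>" "\<And>x. 0 \<le> x \<Longrightarrow> \<phi> x \<le> \<theta> x"
  shows "superlinear \<theta>"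
  unfolding superlinear_def
proof
  fix y
  have "bdd_above ((\<lambda>x. x * y - \<phi> x) ` {0..})"
    using assms(1) by (simp add: superlinear_def)
  then obtain B where B: "\<forall>v\<in>(\<lambda>x. x * y - \<phi> x) ` {0..}. v \<le> B"
    unfolding bdd_above_def by blast
  have "x * y - \<theta> x \<le> B" if "0 \<le> x" for x
  proof -
    have "x * y - \<phi> x \<le> B" using B that by auto
    then show ?thesis using assms(2)[OF that] by linarith
  qed
  then show "bdd_above ((\<lambda>x. x * y - \<theta> x) ` {0..})"
    by (auto simp: bdd_above_def)
qed

lemma conjugate_upper:
  "superlinear \<phi> \<Longrightarrow> 0 \<le> x \<Longrightarrow> x * y - \<phi> x \<le> conjugate \<phi> y"
  unfolding conjugate_def superlinear_def by (intro cSUP_upper) auto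

lemma conjugate_least:
  "(\<And>x. 0 \<le> x \<Longrightarrow> x * y - \<phi> x \<le> B) \<Longrightarrow> conjugate \<phi> y \<le> B"
  unfolding conjugate_def by (intro cSUP_least) auto

lemma conjugate_mono:
  assumes "superlinear \<phi>" "y \<le> z"
  shows "conjugate \<phi> y \<le> conjugate \<phi> z"
proof (rule conjugate_least)
  fix x :: real assume "0 \<le> x"
  then show "x * y - \<phi> x \<le> conjugate \<phi> z"
    using conjugate_upper[OF assms(1), of x z] mult_left_mono[OF assms(2), of x] by linarith
qed

lemma conjugate_nonneg:
  assumes "superlinear \<phi>" "\<phi> 0 = 0"
  shows "0 \<le> conjugate \<phi> y"
  using conjugate_upper[OF assms(1), of 0 y] assms(2) by simp

lemma conjugate_0:
  assumes "superlinear \<phi>" "\<phi> 0 = 0" "\<And>x. 0 \<le> x \<Longrightarrow> 0 \<le> \<phi> x"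
  shows "conjugate \<phi> 0 = 0"
  using conjugate_nonneg[OF assms(1,2), of 0] conjugate_least[of 0 \<phi> 0] assms(3) by fastforce

lemma conjugate_convex:
  assumes "superlinear \<phi>" "0 \<le> l" "0 \<le> m" "l + m = 1"
  shows "conjugate \<phi> (l * y + m * z) \<le> l * conjugate \<phi> y + m * conjugate \<phi> z"
proof (rule conjugate_least)
  fix x :: real assume x: "0 \<le> x"
  have "\<phi> x = (l + m) * \<phi> x" using assms(4) by simp
  then have "x * (l * y + m * z) - \<phi> x = l * (x * y - \<phi> x) + m * (x * z - \<phi> x)"
    by (simp add: algebra_simps)
  also have "\<dots> \<le> l * conjugate \<phi> y + m * conjugate \<phi> z"
    using conjugate_upper[OF assms(1) x] assms(2,3) by (intro add_mono mult_left_mono) auto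
  finally show "x * (l * y + m * z) - \<phi> x \<le> l * conjugate \<phi> y + m * conjugate \<phi> z" .
qed

lemma conjugate_shrink:
  assumes "superlinear \<phi>" "\<phi> 0 = 0" "\<And>x. 0 \<le> x \<Longrightarrow> 0 \<le> \<phi> x" "0 \<le> l" "l \<le> 1"
  shows "conjugate \<phi> (l * y) \<le> l * conjugate \<phi> y"
  using conjugate_convex[OF assms(1,4), of "1 - l" y 0] conjugate_0[OF assms(1-3)] assms(5) by simp

lemma complementary_eq_conjugate:
  assumes "superlinear \<phi>" "\<phi> 0 = 0"
  shows "complementary \<phi> y = ennreal (conjugate \<phi> y)"
proof (rule antisym)
  show "complementary \<phi> y \<le> ennreal (conjugate \<phi> y)"
    unfolding complementary_def
    using conjugate_upper[OF assms(1)] by (intro SUP_least ennreal_leI) auto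
  show "ennreal (conjugate \<phi> y) \<le> complementary \<phi> y"
  proof (cases "complementary \<phi> y = \<infinity>")
    case False
    then obtain B where B: "complementary \<phi> y = ennreal B" "0 \<le> B"
      by (cases "complementary \<phi> y") auto
    have "conjugate \<phi> y \<le> B"
    proof (rule conjugate_least)
      fix x :: real assume "0 \<le> x"
      then have "ennreal (x * y - \<phi> x) \<le> ennreal B"
        unfolding B(1)[symmetric] complementary_def by (intro SUP_upper) auto
      then show "x * y - \<phi> x \<le> B"
        using B(2) by (cases "0 \<le> x * y - \<phi> x") auto
    qed
    then show ?thesis by (simp add: B(1) ennreal_leI)
  qed simp
qed

text \<open>An affine function lies between \<open>l\<close> and \<open>u\<close> with slope \<open>c\<close> precisely when \<open>c\<close> is at least every
  slope from the graph of \<open>u\<close> forward to that of \<open>l\<close>, and at most every slope from \<open>l\<close> forward to \<open>u\<close>.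
  Such a \<open>c\<close> exists as the two segments involved in comparing two such slopes can be cut at a common
  abscissa.\<close>

lemma affine_sandwich:
  fixes l u :: "real \<Rightarrow> real"
  assumes u: "convex_on {0..} u" and l: "concave_on {0..} l"
    and le: "\<And>x. 0 \<le> x \<Longrightarrow> l x \<le> u x"
  obtains c d where "\<And>x. 0 \<le> x \<Longrightarrow> l x \<le> c * x + d" "\<And>x. 0 \<le> x \<Longrightarrow> c * x + d \<le> u x"
proof -
  have cu: "u (a * x + b * y) \<le> a * u x + b * u y"
    if "0 \<le> x" "0 \<le> y" "0 \<le> a" "0 \<le> b" "a + b = 1" for x y a b
  proof -
    have ab: "a = 1 - b" "b \<le> 1" using that by auto
    show ?thesis unfolding ab(1) using convex_onD[OF u, of b x y] that(1,2,4) ab(2) by simp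
  qed
  have cl: "a * l x + b * l y \<le> l (a * x + b * y)"
    if "0 \<le> x" "0 \<le> y" "0 \<le> a" "0 \<le> b" "a + b = 1" for x y a b
  proof -
    have ab: "a = 1 - b" "b \<le> 1" using that by auto
    show ?thesis unfolding ab(1) using concave_onD[OF l, of b x y] that(1,2,4) ab(2) by simp
  qed
  have key: "(l z - u x) / (z - x) \<le> (u z' - l x') / (z' - x')"
    if h: "0 \<le> x" "x < z" "0 \<le> x'" "x' < z'" for x z x' z'
  proof -
    define \<alpha> \<beta> S where "\<alpha> = z - x" and "\<beta> = z' - x'" and "S = \<alpha> + \<beta>"
    have pos: "0 < \<alpha>" "0 < \<beta>" "0 < S" using h by (auto simp: \<alpha>_def \<beta>_def S_def)
    \<comment> \<open>The weights \<open>\<beta> / S\<close> and \<open>\<alpha> / S\<close> carry the pair \<open>z\<close>, \<open>x'\<close> and the pair \<open>x\<close>, \<open>z'\<close> to the same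
      point, where \<open>l \<le> u\<close> applies.\<close>
    define w where "w = (z * z' - x * x') / S"
    have "z * z' - x * x' = \<beta> * z + \<alpha> * x'"
      by (simp add: \<alpha>_def \<beta>_def algebra_simps)
    then have w1: "w = (\<beta> / S) * z + (\<alpha> / S) * x'"
      by (simp add: w_def add_divide_distrib)
    have "z * z' - x * x' = \<alpha> * z' + \<beta> * x"
      by (simp add: \<alpha>_def \<beta>_def algebra_simps)
    then have w2: "w = (\<alpha> / S) * z' + (\<beta> / S) * x"
      by (simp add: w_def add_divide_distrib)
    have sum1: "\<beta> / S + \<alpha> / S = 1" using pos(3) by (simp add: S_def flip: add_divide_distrib)
    have "0 \<le> w" unfolding w1 using h pos by simp
    have "(\<beta> / S) * l z + (\<alpha> / S) * l x' \<le> l w"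
      unfolding w1 using pos h sum1 by (intro cl) auto
    also have "\<dots> \<le> u w" using le[OF \<open>0 \<le> w\<close>] .
    also have "\<dots> \<le> (\<alpha> / S) * u z' + (\<beta> / S) * u x"
      unfolding w2 using pos h sum1 by (intro cu) auto
    finally have "(\<beta> * l z + \<alpha> * l x') / S \<le> (\<alpha> * u z' + \<beta> * u x) / S"
      by (simp add: add_divide_distrib)
    then have "\<beta> * l z + \<alpha> * l x' \<le> \<alpha> * u z' + \<beta> * u x"
      using pos(3) by (simp add: divide_le_cancel)
    then have "\<beta> * (l z - u x) \<le> \<alpha> * (u z' - l x')"
      by (simp add: algebra_simps)
    then have "(l z - u x) / \<alpha> \<le> (u z' - l x') / \<beta>"
      using pos by (simp add: field_simps)
    then show ?thesis by (simp add: \<alpha>_def \<beta>_def)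
  qed
  define A where "A = {(l z - u x) / (z - x) |x z. 0 \<le> x \<and> x < z}"
  have A: "(l z - u x) / (z - x) \<in> A" if "0 \<le> x" "x < z" for x z
    using that by (auto simp: A_def)
  have ne: "A \<noteq> {}" using A[of 0 1] by auto
  have up: "v \<le> (u z' - l x') / (z' - x')" if "v \<in> A" "0 \<le> x'" "x' < z'" for v x' z'
    using that key by (auto simp: A_def)
  have bdd: "bdd_above A" using up[of _ 0 1] by (auto simp: bdd_above_def)
  define c where "c = Sup A"
  have sep: "l x - c * x \<le> u z - c * z" if "0 \<le> x" "0 \<le> z" for x z
  proof -
    consider "x = z" | "x < z" | "z < x" by linarith
    then show ?thesis
    proof cases
      case 1 then show ?thesis using le that by simp
    next
      case 2
      then have "c \<le> (u z - l x) / (z - x)"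
        unfolding c_def using up that by (intro cSup_least ne) auto
      then show ?thesis using 2 by (simp add: field_simps)
    next
      case 3
      then have "(l x - u z) / (x - z) \<le> c"
        unfolding c_def using A that by (intro cSup_upper bdd) auto
      then show ?thesis using 3 by (simp add: field_simps)
    qed
  qed
  define d where "d = (SUP x\<in>{0..}. l x - c * x)"
  have bdd': "bdd_above ((\<lambda>x. l x - c * x) ` {0..})"
    using sep[of _ 0] by (auto simp: bdd_above_def)
  have "l x \<le> c * x + d" if "0 \<le> x" for x
    using cSUP_upper[OF _ bdd', of x] that by (simp add: d_def)
  moreover have "c * z + d \<le> u z" if "0 \<le> z" for z
  proof -
    have "d \<le> u z - c * z"
      unfolding d_def using sep that by (intro cSUP_least) auto
    then show ?thesis by simp
  qed
  ultimately show thesis using that by blast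
qed

text \<open>The conjugate of a sum is the infimal convolution of the conjugates, and the infimum is attained: an
  affine function separating \<open>a x - \<Phi>(x) - \<Psi>(a)\<close> from \<open>\<phi>(x)\<close> has a slope \<open>c\<close> for which \<open>a - c\<close> and \<open>c\<close> is an
  optimal splitting of \<open>a\<close>. Varying only the second summand gives a majorant of \<open>\<Psi>\<close> that is exact at \<open>a\<close> and is a
  translate of the conjugate of \<open>\<phi>\<close>, so upper bounds for second differences pass from the latter to \<open>\<Psi>\<close>.\<close>

lemma conjugate_add_touching:
  assumes \<Phi>: "young_function \<Phi>" and \<phi>: "young_function \<phi>" "superlinear \<phi>"
    and a: "0 \<le> a"
  obtains c where "0 \<le> c" "c \<le> a"
    "\<And>y. conjugate (\<lambda>x. \<Phi> x + \<phi> x) (a - c + y)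
        \<le> conjugate (\<lambda>x. \<Phi> x + \<phi> x) a - conjugate \<phi> c + conjugate \<phi> y"
proof -
  let ?F = "\<lambda>x. \<Phi> x + \<phi> x"
  have nn: "0 \<le> \<Phi> x" "0 \<le> \<phi> x" if "0 \<le> x" for x
    using young_nonneg \<Phi> \<phi>(1) that by blast+
  have sl: "superlinear ?F"
    using superlinear_mono[OF \<phi>(2), of ?F] nn by simp
  define l where "l x = a * x - \<Phi> x - conjugate ?F a" for x
  have 1: "concave_on {0..} l"
  proof -
    have "convex_on {0..} (\<lambda>x. \<Phi> x + ((- a) * x + conjugate ?F a))"
      using \<Phi> by (intro convex_on_add)
        (auto simp: young_function_def convex_on_def algebra_simps simp flip: distrib_right)
    moreover have "(\<lambda>x. - l x) = (\<lambda>x. \<Phi> x + ((- a) * x + conjugate ?F a))"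
      by (auto simp: l_def)
    ultimately show ?thesis unfolding concave_on_def by simp
  qed
  have 2: "l x \<le> \<phi> x" if "0 \<le> x" for x
    using conjugate_upper[OF sl that, of a] by (simp add: l_def mult.commute)
  obtain c0 d where c0: "\<And>x. 0 \<le> x \<Longrightarrow> l x \<le> c0 * x + d" "\<And>x. 0 \<le> x \<Longrightarrow> c0 * x + d \<le> \<phi> x"
    using affine_sandwich[OF _ 1 2] \<phi>(1) by (auto simp: young_function_def)
  have z: "\<Phi> 0 = 0" "\<phi> 0 = 0" using \<Phi> \<phi>(1) by (auto simp: young_function_def)
  have d: "d \<le> 0" "- conjugate ?F a \<le> d" using c0[of 0] z by (auto simp: l_def)
  \<comment> \<open>The slope \<open>c0\<close> need not lie in \<open>[0, a]\<close>, but moving it to the nearest point there keeps the affine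
    function between the two graphs, as \<open>\<phi> \<ge> 0\<close>, \<open>\<Phi> \<ge> 0\<close> and \<open>- \<Psi>(a) \<le> d \<le> 0\<close>.\<close>
  define c where "c = max 0 (min a c0)"
  have c: "0 \<le> c" "c \<le> a" using a by (auto simp: c_def)
  have lo: "l x \<le> c * x + d" if "0 \<le> x" for x
  proof -
    consider "c0 \<le> c" | "c = a" unfolding c_def using a by linarith
    then show ?thesis
    proof cases
      case 1
      then show ?thesis using c0(1)[OF that] mult_right_mono[OF 1 that] by linarith
    next
      case 2
      then show ?thesis using nn(1)[OF that] d by (simp add: l_def)
    qed
  qed
  have hi: "c * x + d \<le> \<phi> x" if "0 \<le> x" for x
  proof -
    consider "c \<le> c0" | "c = 0" unfolding c_def using a by linarith
    then show ?thesis
    proof cases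
      case 1
      then show ?thesis using c0(2)[OF that] mult_right_mono[OF 1 that] by linarith
    next
      case 2
      then show ?thesis using nn(2)[OF that] d by simp
    qed
  qed
  have \<psi>c: "conjugate \<phi> c \<le> - d"
    using hi by (intro conjugate_least) (smt (verit) mult.commute)
  show thesis
  proof (rule that[OF c])
    fix y
    show "conjugate ?F (a - c + y) \<le> conjugate ?F a - conjugate \<phi> c + conjugate \<phi> y"
    proof (rule conjugate_least)
      fix x :: real assume x: "0 \<le> x"
      have "x * y - \<phi> x \<le> conjugate \<phi> y" by (rule conjugate_upper[OF \<phi>(2) x])
      moreover have "a * x - \<Phi> x - conjugate ?F a \<le> c * x + d" using lo[OF x] by (simp add: l_def)
      ultimately show "x * (a - c + y) - ?F x \<le> conjugate ?F a - conjugate \<phi> c + conjugate \<phi> y"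
        using \<psi>c by (simp add: algebra_simps)
    qed
  qed
qed

section \<open>Conjugates of functions of power type\<close>

lemma exp_le_quadratic: "exp x \<le> 1 + x + x\<^sup>2 * exp \<bar>x\<bar>" for x :: real
proof (cases "0 \<le> x")
  case True
  have "exp x * (1 - x) \<le> exp x * exp (- x)"
    using exp_ge_add_one_self[of "- x"] by (intro mult_left_mono) auto
  then have *: "exp x - 1 \<le> x * exp x" by (simp add: exp_minus algebra_simps)
  then have "x * (exp x - 1) \<le> x * (x * exp x)" using True by (rule mult_left_mono)
  with * True show ?thesis by (simp add: power2_eq_square algebra_simps)
next
  case False
  have "exp x * (1 - x) \<le> exp x * exp (- x)"
    using exp_ge_add_one_self[of "- x"] by (intro mult_left_mono) auto
  then have *: "exp x - 1 - x \<le> (- x) * (1 - exp x)" by (simp add: exp_minus algebra_simps)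
  also have "\<dots> \<le> (- x) * (- x)"
    using False exp_ge_add_one_self[of x] by (intro mult_left_mono) linarith+
  also have "\<dots> \<le> x\<^sup>2 * exp \<bar>x\<bar>"
    using mult_left_mono[of 1 "exp \<bar>x\<bar>" "x\<^sup>2"] by (simp add: power2_eq_square)
  finally show ?thesis by simp
qed

text \<open>Bounding \<open>|1 + w|\<^sup>2 = 1 + 2 Re w + |w|\<^sup>2\<close> by an exponential reduces all exponents \<open>q\<close> to the
  second order estimate for \<open>exp\<close>, in which the linear term \<open>q Re w\<close> averages out.\<close>

lemma weighted_power_second_order:
  fixes z :: complex and q l m :: real
  assumes q: "0 < q" and lm: "0 \<le> l" "0 \<le> m" "l + m = 1" and z: "cmod z \<le> 1"
  shows "l * cmod (1 + m * z) powr q + m * cmod (1 - l * z) powr q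
      \<le> 1 + (q + 4 * q\<^sup>2 * exp (2 * q)) * (cmod z)\<^sup>2"
proof -
  let ?C = "q + 4 * q\<^sup>2 * exp (2 * q)"
  have one: "cmod (1 + w) powr q \<le> 1 + q * Re w + ?C * (cmod z)\<^sup>2" if w: "cmod w \<le> cmod z" for w
  proof -
    define x where "x = q * Re w + q / 2 * (cmod w)\<^sup>2"
    have w1: "cmod w \<le> 1" using w z by simp
    have ww: "(cmod w)\<^sup>2 \<le> cmod w" using w1 by (simp add: power2_eq_square mult_left_le)
    have w2: "(cmod w)\<^sup>2 \<le> (cmod z)\<^sup>2" using w by (simp add: power_mono)
    have "\<bar>x\<bar> \<le> q * \<bar>Re w\<bar> + q / 2 * (cmod w)\<^sup>2"
      unfolding x_def using q by (intro order_trans[OF abs_triangle_ineq]) (simp add: abs_mult)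
    also have "\<dots> \<le> q * cmod w + q / 2 * cmod w"
      using q ww abs_Re_le_cmod[of w] by (intro add_mono mult_left_mono) auto
    finally have x: "\<bar>x\<bar> \<le> 2 * q * cmod w" using q by (simp add: algebra_simps)
    have "cmod (1 + w) = ((cmod (1 + w))\<^sup>2) powr (1/2)" by (simp add: powr_half_sqrt)
    also have "(cmod (1 + w))\<^sup>2 = 1 + (2 * Re w + (cmod w)\<^sup>2)"
      by (simp only: cmod_power2) (simp add: power2_eq_square algebra_simps)
    finally have "cmod (1 + w) powr q = (1 + (2 * Re w + (cmod w)\<^sup>2)) powr (q / 2)"
      by (simp add: powr_powr)
    also have "\<dots> \<le> exp (2 * Re w + (cmod w)\<^sup>2) powr (q / 2)"
      using q \<open>(cmod (1 + w))\<^sup>2 = _\<close>[symmetric] exp_ge_add_one_self[of "2 * Re w + (cmod w)\<^sup>2"]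
      by (intro powr_mono2) auto
    also have "\<dots> = exp x" by (simp add: powr_def x_def algebra_simps)
    also have "\<dots> \<le> 1 + x + x\<^sup>2 * exp \<bar>x\<bar>" by (rule exp_le_quadratic)
    also have "x\<^sup>2 * exp \<bar>x\<bar> \<le> (4 * q\<^sup>2 * (cmod w)\<^sup>2) * exp (2 * q)"
    proof (intro mult_mono)
      have "\<bar>x\<bar>\<^sup>2 \<le> (2 * q * cmod w)\<^sup>2" using x by (intro power_mono) auto
      then show "x\<^sup>2 \<le> 4 * q\<^sup>2 * (cmod w)\<^sup>2" by (simp add: power_mult_distrib)
      have "2 * q * cmod w \<le> 2 * q * 1" using q w1 by (intro mult_left_mono) auto
      then show "exp \<bar>x\<bar> \<le> exp (2 * q)" using x by simp
    qed auto
    also have "(4 * q\<^sup>2 * (cmod w)\<^sup>2) * exp (2 * q) \<le> (4 * q\<^sup>2 * (cmod z)\<^sup>2) * exp (2 * q)"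
      using w2 by (intro mult_right_mono mult_left_mono) auto
    also have "1 + x \<le> 1 + (q * Re w + q * (cmod z)\<^sup>2)"
      unfolding x_def using q w2 by (intro add_left_mono mult_mono) auto
    finally show ?thesis by (simp add: algebra_simps)
  qed
  have "cmod (m * z) \<le> cmod z" "cmod (- (l * z)) \<le> cmod z"
    using lm by (auto simp: norm_mult mult_left_le_one_le)
  then have "l * cmod (1 + m * z) powr q + m * cmod (1 + (- (l * z))) powr q
      \<le> l * (1 + q * Re (m * z) + ?C * (cmod z)\<^sup>2) + m * (1 + q * Re (- (l * z)) + ?C * (cmod z)\<^sup>2)"
    using lm by (intro add_mono mult_left_mono one) auto
  also have "\<dots> = (l + m) * (1 + ?C * (cmod z)\<^sup>2)" by (simp add: algebra_simps)
  finally show ?thesis using lm by simp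
qed

lemma two_term_Hoelder:
  fixes p q :: real
  assumes p: "1 < p" "1 < q" "1 / p + 1 / q = 1" and lm: "0 \<le> l" "0 \<le> m"
    and nn: "0 \<le> x1" "0 \<le> x2" "0 \<le> y1" "0 \<le> y2"
  shows "l * (x1 * y1) + m * (x2 * y2)
      \<le> (l * x1 powr p + m * x2 powr p) powr (1/p) * (l * y1 powr q + m * y2 powr q) powr (1/q)"
proof -
  define X Y where "X = (l * x1 powr p + m * x2 powr p) powr (1/p)"
    and "Y = (l * y1 powr q + m * y2 powr q) powr (1/q)"
  have Xp: "X powr p = l * x1 powr p + m * x2 powr p"
    using p lm by (simp add: X_def powr_powr)
  have Yq: "Y powr q = l * y1 powr q + m * y2 powr q"
    using p lm by (simp add: Y_def powr_powr)
  have XY: "0 \<le> X" "0 \<le> Y" by (auto simp: X_def Y_def)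
  show ?thesis
  proof (cases "X = 0 \<or> Y = 0")
    case True
    have "l * x1 = 0 \<and> m * x2 = 0 \<or> l * y1 = 0 \<and> m * y2 = 0"
    proof (cases "X = 0")
      case True
      with Xp p lm have "l * x1 powr p = 0 \<and> m * x2 powr p = 0"
        by (simp add: add_nonneg_eq_0_iff)
      then show ?thesis by auto
    next
      case False
      with True Yq p lm have "l * y1 powr q = 0 \<and> m * y2 powr q = 0"
        by (simp add: add_nonneg_eq_0_iff)
      then show ?thesis by auto
    qed
    then have "l * (x1 * y1) + m * (x2 * y2) = 0" by auto
    then show ?thesis by simp
  next
    case False
    then have pos: "0 < X" "0 < Y" using XY by auto
    have young: "(x / X) * (y / Y) \<le> x powr p / X powr p / p + y powr q / Y powr q / q"
      if "0 \<le> x" "0 \<le> y" for x y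
      using Youngs_inequality[of p q "x / X" "y / Y"] p pos that by (simp add: powr_divide)
    have "l * ((x1 / X) * (y1 / Y)) + m * ((x2 / X) * (y2 / Y))
        \<le> l * (x1 powr p / X powr p / p + y1 powr q / Y powr q / q)
          + m * (x2 powr p / X powr p / p + y2 powr q / Y powr q / q)"
      using lm nn by (intro add_mono mult_left_mono young) auto
    also have "\<dots> = (l * x1 powr p + m * x2 powr p) / X powr p / p
        + (l * y1 powr q + m * y2 powr q) / Y powr q / q"
      by (simp add: add_divide_distrib algebra_simps)
    also have "\<dots> = 1" using pos p by (simp flip: Xp Yq)
    finally have "(l * (x1 * y1) + m * (x2 * y2)) / (X * Y) \<le> 1"
      by (simp add: add_divide_distrib)
    then show ?thesis using pos by (simp add: X_def Y_def)
  qed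
qed

text \<open>The boundary point \<open>0\<close> is included, unlike in \<open>powr_convex\<close>.\<close>

lemma powr_convex_atLeast:
  assumes p: "1 \<le> p"
  shows "convex_on {0..} (\<lambda>x::real. x powr p)"
proof (rule convex_onI)
  fix t x y :: real assume h: "0 < t" "t < 1" "x \<in> {0..}" "y \<in> {0..}"
  have le: "a powr p \<le> a" if "0 < a" "a < 1" for a :: real
    using powr_mono'[OF p, of a] that by simp
  consider "x = 0" | "y = 0" | "0 < x" "0 < y" using h by fastforce
  then show "((1 - t) *\<^sub>R x + t *\<^sub>R y) powr p \<le> (1 - t) * x powr p + t * y powr p"
  proof cases
    case 1
    then show ?thesis using le[of t] h by (simp add: powr_mult mult_right_mono)
  next
    case 2
    then show ?thesis using le[of "1 - t"] h by (simp add: powr_mult mult_right_mono)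
  next
    case 3
    then show ?thesis using convex_onD[OF powr_convex[OF p], of t x y] h by simp
  qed
qed simp

text \<open>Assumption \<open>power_convex\<close> says that \<open>\<phi>(u\<^sup>1\<^sup>/\<^sup>p)\<close> is convex and nondecreasing in \<open>u\<close>, and
  \<open>power_scale\<close> is what concavity of \<open>\<phi>(u\<^sup>1\<^sup>/\<^sup>s)\<close> would give; the latter form survives the construction of
  \<open>power_hull\<close> below, where concavity may be lost. The exponents \<open>q\<close> and \<open>\<sigma>\<close> are dual to \<open>p\<close> and \<open>s\<close>.\<close>

locale power_type =
  fixes \<phi> :: "real \<Rightarrow> real" and p q s \<sigma> :: real
  assumes exponents: "1 < p" "1 / p + 1 / q = 1" "1 < s" "1 / s + 1 / \<sigma> = 1" "\<sigma> \<le> 2"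
    and zero: "\<phi> 0 = 0"
    and power_convex: "\<And>x y z l m. \<lbrakk>0 \<le> x; 0 \<le> y; 0 \<le> z; 0 \<le> l; 0 \<le> m; l + m = 1;
        z powr p \<le> l * x powr p + m * y powr p\<rbrakk> \<Longrightarrow> \<phi> z \<le> l * \<phi> x + m * \<phi> y"
    and power_scale: "\<And>l x. \<lbrakk>0 \<le> l; l \<le> 1; 0 \<le> x\<rbrakk> \<Longrightarrow> l powr s * \<phi> x \<le> \<phi> (l * x)"
    and superlinear: "superlinear \<phi>"
begin

abbreviation \<psi> :: "real \<Rightarrow> real" where "\<psi> \<equiv> conjugate \<phi>"

lemma q_gt_1: "1 < q" and \<sigma>_gt_1: "1 < \<sigma>"
proof -
  have *: "1 < b" if "1 < a" "1 / a + 1 / b = 1" for a b :: real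
  proof -
    have "1 / b = 1 - 1 / a" using that(2) by linarith
    also have "\<dots> > 0" using that(1) by simp
    finally have "0 < b" by (simp add: zero_less_divide_iff)
    moreover have "1 / b < 1" using that by (smt (verit) divide_pos_pos)
    ultimately show "1 < b" by simp
  qed
  show "1 < q" "1 < \<sigma>" using exponents by (blast intro: *)+
qed

lemma nonneg: "0 \<le> \<phi> x" if "0 \<le> x"
  using power_convex[of x x 0 1 0] that exponents zero by simp

lemma mono: "\<phi> x \<le> \<phi> y" if "0 \<le> x" "x \<le> y"
  using power_convex[of y y x 1 0] that exponents by (simp add: powr_mono2)

lemma young: "young_function \<phi>"
  unfolding young_function_def
proof (intro conjI mono_onI)
  show "convex_on {0..} \<phi>"
  proof (rule convex_onI)
    fix t x y :: real assume h: "0 < t" "t < 1" "x \<in> {0..}" "y \<in> {0..}"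
    have "((1 - t) * x + t * y) powr p \<le> (1 - t) * x powr p + t * y powr p"
      using convex_onD[OF powr_convex_atLeast[of p], of t x y] exponents h by auto
    then show "\<phi> ((1 - t) *\<^sub>R x + t *\<^sub>R y) \<le> (1 - t) * \<phi> x + t * \<phi> y"
      using h by (intro power_convex) auto
  qed simp
qed (use mono zero in auto)

lemma \<psi>_mono: "y \<le> z \<Longrightarrow> \<psi> y \<le> \<psi> z"
  by (rule conjugate_mono[OF superlinear])

lemma \<psi>_nonneg: "0 \<le> \<psi> y"
  by (rule conjugate_nonneg[OF superlinear zero])

lemma \<psi>_0: "\<psi> 0 = 0"
  by (rule conjugate_0[OF superlinear zero nonneg])

text \<open>The function \<open>\<psi>(v\<^sup>1\<^sup>/\<^sup>q)\<close> is concave in \<open>v\<close>. With \<open>x = u\<^sup>1\<^sup>/\<^sup>p\<close> it is the supremum over \<open>u\<close> of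
  \<open>u\<^sup>1\<^sup>/\<^sup>p v\<^sup>1\<^sup>/\<^sup>q - \<phi>(u\<^sup>1\<^sup>/\<^sup>p)\<close>, which is jointly concave in \<open>u\<close> and \<open>v\<close> by Hoelder's inequality; and partial
  maximisation preserves concavity.\<close>

lemma conjugate_power_concave:
  assumes lm: "0 \<le> l" "0 \<le> m" "l + m = 1" and y: "0 \<le> y1" "0 \<le> y2"
  shows "l * \<psi> y1 + m * \<psi> y2 \<le> \<psi> ((l * y1 powr q + m * y2 powr q) powr (1/q))"
proof -
  define Y where "Y = (l * y1 powr q + m * y2 powr q) powr (1/q)"
  have *: "l * (x1 * y1 - \<phi> x1) + m * (x2 * y2 - \<phi> x2) \<le> \<psi> Y" if x: "0 \<le> x1" "0 \<le> x2" for x1 x2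
  proof -
    define X where "X = (l * x1 powr p + m * x2 powr p) powr (1/p)"
    have "X powr p = l * x1 powr p + m * x2 powr p"
      using exponents lm by (simp add: X_def powr_powr)
    then have "\<phi> X \<le> l * \<phi> x1 + m * \<phi> x2"
      using x lm by (intro power_convex) (auto simp: X_def)
    moreover have "l * (x1 * y1) + m * (x2 * y2) \<le> X * Y"
      unfolding X_def Y_def using exponents q_gt_1 lm x y by (intro two_term_Hoelder) auto
    moreover have "X * Y - \<phi> X \<le> \<psi> Y"
      by (rule conjugate_upper[OF superlinear]) (simp add: X_def)
    ultimately show ?thesis by (simp add: algebra_simps)
  qed
  have **: "l * \<psi> y1 + m * (x2 * y2 - \<phi> x2) \<le> \<psi> Y" if x2: "0 \<le> x2" for x2
  proof (cases "l = 0")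
    case True
    then show ?thesis using *[of 0 x2] x2 by simp
  next
    case False
    then have "0 < l" using lm by simp
    then have "\<psi> y1 \<le> (\<psi> Y - m * (x2 * y2 - \<phi> x2)) / l"
      using *[OF _ x2] by (intro conjugate_least) (simp add: field_simps)
    then show ?thesis using \<open>0 < l\<close> by (simp add: field_simps)
  qed
  have "l * \<psi> y1 + m * \<psi> y2 \<le> \<psi> Y"
  proof (cases "m = 0")
    case True
    then show ?thesis using **[of 0] by simp
  next
    case False
    then have "0 < m" using lm by simp
    then have "\<psi> y2 \<le> (\<psi> Y - l * \<psi> y1) / m"
      using ** by (intro conjugate_least) (simp add: field_simps)
    then show ?thesis using \<open>0 < m\<close> by (simp add: field_simps)
  qed
  then show ?thesis by (simp add: Y_def)
qed

lemma conjugate_expand: "\<psi> (k * y) \<le> k powr q * \<psi> y" if k: "1 \<le> k" and y: "0 \<le> y"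
proof -
  define l where "l = k powr (- q)"
  have l: "0 < l" "l \<le> 1" using k q_gt_1 by (auto simp: l_def powr_le1 powr_minus_divide ge_one_powr_ge_zero)
  have "l * (k * y) powr q = y powr q"
    using k y by (simp add: l_def powr_mult powr_minus)
  then have "l * \<psi> (k * y) + (1 - l) * \<psi> 0 \<le> \<psi> ((y powr q) powr (1/q))"
    using conjugate_power_concave[of l "1 - l" "k * y" 0] l k y q_gt_1 by simp
  then have "l * \<psi> (k * y) \<le> \<psi> y" using \<psi>_0 q_gt_1 y by (simp add: powr_powr)
  then show ?thesis using l k by (simp add: l_def powr_minus field_simps)
qed

text \<open>Dual to \<open>power_scale\<close>: substitute \<open>x = k\<^sup>\<sigma>\<^sup>-\<^sup>1 z\<close> in the supremum and use \<open>(\<sigma> - 1) s = \<sigma>\<close>.\<close>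

lemma conjugate_power_convex: "\<psi> (k * y) \<le> k powr \<sigma> * \<psi> y" if k: "0 \<le> k" "k \<le> 1"
proof (cases "k = 0")
  case True
  then show ?thesis by (simp add: \<psi>_0)
next
  case False
  then have "0 < k" using k by simp
  define j where "j = k powr (\<sigma> - 1)"
  have j: "0 < j" "j \<le> 1" using \<open>0 < k\<close> k \<sigma>_gt_1 by (auto simp: j_def powr_le1)
  have "(\<sigma> - 1) * s = \<sigma>" using exponents \<sigma>_gt_1 by (simp add: field_simps)
  then have js: "j powr s = k powr \<sigma>" by (simp add: j_def powr_powr)
  have jk: "j * k = k powr \<sigma>" using \<open>0 < k\<close> by (simp add: j_def powr_diff)
  show ?thesis
  proof (rule conjugate_least)
    fix x :: real assume x: "0 \<le> x"
    define z where "z = x / j"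
    have z: "0 \<le> z" "x = j * z" using x j by (auto simp: z_def)
    have "x * (k * y) - \<phi> x \<le> (j * z) * (k * y) - j powr s * \<phi> z"
      unfolding z(2) using power_scale[of j z] j z(1) by simp
    also have "\<dots> = (j * k) * (z * y) - k powr \<sigma> * \<phi> z" by (simp add: js algebra_simps)
    also have "\<dots> = k powr \<sigma> * (z * y - \<phi> z)" by (simp add: jk algebra_simps)
    also have "\<dots> \<le> k powr \<sigma> * \<psi> y"
      by (intro mult_left_mono conjugate_upper[OF superlinear z(1)]) simp
    finally show "x * (k * y) - \<phi> x \<le> k powr \<sigma> * \<psi> y" .
  qed
qed

definition smoothness_const :: real where
  "smoothness_const = q + 4 * q\<^sup>2 * exp (2 * q) + 2 powr q"

lemma smoothness_const_nonneg: "0 \<le> smoothness_const"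
  using q_gt_1 by (simp add: smoothness_const_def)

text \<open>For \<open>|D| \<le> |c|\<close>, concavity in the \<open>q\<close>-th power and \<open>weighted_power_second_order\<close> bound the excess by a
  multiple of \<open>|D / c|\<^sup>2 \<psi>(|c|)\<close>. As \<open>\<sigma> \<le> 2\<close> this is at most \<open>\<tau>\<^sup>\<sigma> (d / |c|)\<^sup>\<sigma> \<psi>(|c|)\<close>, and
  \<open>conjugate_power_convex\<close> absorbs \<open>(d / |c|)\<^sup>\<sigma>\<close> if \<open>d > |c|\<close>. For \<open>|D| > |c|\<close> the crude bound
  \<open>\<psi>(2 \<tau> d)\<close> is already of order \<open>\<tau>\<^sup>\<sigma>\<close>. The weights are allowed to be unequal because \<open>h\<^sub>1 + \<tau> h\<^sub>2\<close> and \<open>h\<^sub>1 - \<tau> h\<^sub>2\<close> will be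
  divided by different numbers.\<close>

lemma conjugate_smooth:
  fixes c D :: complex and l m \<tau> d :: real
  assumes lm: "0 \<le> l" "0 \<le> m" "l + m = 1"
    and D: "cmod D \<le> \<tau> * d" and \<tau>: "0 \<le> \<tau>" "\<tau> \<le> 1" and d: "0 \<le> d"
  shows "l * \<psi> (cmod (c + m * D)) + m * \<psi> (cmod (c - l * D))
      \<le> \<psi> (cmod c) + smoothness_const * \<tau> powr \<sigma> * (\<psi> (cmod c) + \<psi> d)"
proof -
  define C1 where "C1 = q + 4 * q\<^sup>2 * exp (2 * q)"
  have C1: "0 \<le> C1" using q_gt_1 by (simp add: C1_def)
  have l1: "l \<le> 1" using lm by linarith
  have "l * \<psi> (cmod (c + m * D)) + m * \<psi> (cmod (c - l * D))
      \<le> \<psi> (cmod c) + (C1 + 2 powr q) * (\<tau> powr \<sigma> * (\<psi> (cmod c) + \<psi> d))"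
  proof (cases "cmod D \<le> cmod c")
    case True
    show ?thesis
    proof (cases "c = 0")
      case True
      then have "D = 0" using \<open>cmod D \<le> cmod c\<close> by simp
      then show ?thesis using True \<psi>_nonneg[of d] C1 by (simp add: \<psi>_0)
    next
      case False
      define z where "z = D / c"
      have z: "cmod z \<le> 1" using True False by (simp add: z_def norm_divide)
      have cz: "c + m * D = c * (1 + m * z)" "c - l * D = c * (1 - l * z)"
        using False by (simp_all add: z_def algebra_simps)
      define E where "E = C1 * (cmod z)\<^sup>2"
      have E: "0 \<le> E" using C1 by (simp add: E_def)
      have "l * cmod (c + m * D) powr q + m * cmod (c - l * D) powr q
          = cmod c powr q * (l * cmod (1 + m * z) powr q + m * cmod (1 - l * z) powr q)"
        unfolding cz norm_mult by (simp add: powr_mult algebra_simps)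
      also have "\<dots> \<le> cmod c powr q * (1 + E)"
        unfolding E_def C1_def using q_gt_1 lm z
        by (intro mult_left_mono weighted_power_second_order) auto
      finally have "(l * cmod (c + m * D) powr q + m * cmod (c - l * D) powr q) powr (1/q)
          \<le> (cmod c powr q * (1 + E)) powr (1/q)"
        using q_gt_1 lm by (intro powr_mono2) auto
      also have "\<dots> = (1 + E) powr (1/q) * cmod c"
        using q_gt_1 E by (simp add: powr_mult powr_powr)
      finally have "l * \<psi> (cmod (c + m * D)) + m * \<psi> (cmod (c - l * D)) \<le> \<psi> ((1 + E) powr (1/q) * cmod c)"
        using lm by (intro order_trans[OF conjugate_power_concave \<psi>_mono]) auto
      also have "\<dots> \<le> ((1 + E) powr (1/q)) powr q * \<psi> (cmod c)"
        using E q_gt_1 by (intro conjugate_expand ge_one_powr_ge_zero) auto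
      also have "\<dots> = (1 + E) * \<psi> (cmod c)" using E q_gt_1 by (simp add: powr_powr)
      also have "\<dots> = \<psi> (cmod c) + C1 * ((cmod z)\<^sup>2 * \<psi> (cmod c))" by (simp add: E_def algebra_simps)
      also have "(cmod z)\<^sup>2 * \<psi> (cmod c) \<le> \<tau> powr \<sigma> * (\<psi> (cmod c) + \<psi> d)"
      proof -
        have "(cmod z)\<^sup>2 = cmod z powr 2" by simp
        also have "\<dots> \<le> cmod z powr \<sigma>"
          using z exponents(5) by (intro powr_mono') auto
        also have "\<dots> \<le> (\<tau> * (d / cmod c)) powr \<sigma>"
          using D \<sigma>_gt_1 by (intro powr_mono2) (auto simp: z_def norm_divide divide_right_mono)
        also have "\<dots> = \<tau> powr \<sigma> * (d / cmod c) powr \<sigma>"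
          using \<tau> d by (simp add: powr_mult del: times_divide_eq_right)
        finally have "(cmod z)\<^sup>2 * \<psi> (cmod c) \<le> \<tau> powr \<sigma> * (d / cmod c) powr \<sigma> * \<psi> (cmod c)"
          by (rule mult_right_mono) (rule \<psi>_nonneg)
        also have "\<dots> = \<tau> powr \<sigma> * ((d / cmod c) powr \<sigma> * \<psi> (cmod c))" by simp
        also have "(d / cmod c) powr \<sigma> * \<psi> (cmod c) \<le> \<psi> (cmod c) + \<psi> d"
        proof (cases "d \<le> cmod c")
          case True
          then have "(d / cmod c) powr \<sigma> \<le> 1"
            using False d \<sigma>_gt_1 by (intro powr_le1) (auto simp: divide_le_eq_1)
          then have "(d / cmod c) powr \<sigma> * \<psi> (cmod c) \<le> \<psi> (cmod c)"
            using \<psi>_nonneg by (intro mult_left_le_one_le) auto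
          then show ?thesis using \<psi>_nonneg[of d] by simp
        next
          case dc: False
          then have d0: "0 < d" using norm_ge_zero[of c] by linarith
          have "\<psi> (cmod c) \<le> (cmod c / d) powr \<sigma> * \<psi> d"
            using conjugate_power_convex[of "cmod c / d" d] dc d0 by simp
          then have "(d / cmod c) powr \<sigma> * \<psi> (cmod c)
              \<le> (d / cmod c) powr \<sigma> * ((cmod c / d) powr \<sigma> * \<psi> d)"
            by (rule mult_left_mono) simp
          also have "\<dots> = \<psi> d" using d0 False by (simp add: powr_divide)
          finally show ?thesis using \<psi>_nonneg[of "cmod c"] by simp
        qed
        finally show ?thesis by (simp add: mult_left_mono)
      qed
      finally have "l * \<psi> (cmod (c + m * D)) + m * \<psi> (cmod (c - l * D))
          \<le> \<psi> (cmod c) + C1 * (\<tau> powr \<sigma> * (\<psi> (cmod c) + \<psi> d))"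
        using C1 by (simp add: mult_left_mono)
      moreover have "0 \<le> 2 powr q * (\<tau> powr \<sigma> * (\<psi> (cmod c) + \<psi> d))"
        using \<psi>_nonneg by simp
      ultimately show ?thesis unfolding distrib_right[of C1] by linarith
    qed
  next
    case False
    have b: "\<psi> (cmod (c + D')) \<le> 2 powr q * (\<tau> powr \<sigma> * \<psi> d)" if "cmod D' \<le> cmod D" for D'
    proof -
      have "cmod (c + D') \<le> 2 * (\<tau> * d)"
        using norm_triangle_ineq[of c D'] that False D by linarith
      then have "\<psi> (cmod (c + D')) \<le> \<psi> (2 * (\<tau> * d))" by (rule \<psi>_mono)
      also have "\<dots> \<le> 2 powr q * \<psi> (\<tau> * d)" using \<tau> d by (intro conjugate_expand) auto
      also have "\<dots> \<le> 2 powr q * (\<tau> powr \<sigma> * \<psi> d)"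
        using \<tau> by (intro mult_left_mono conjugate_power_convex) auto
      finally show ?thesis .
    qed
    have "cmod (m * D) \<le> cmod D" "cmod (- (l * D)) \<le> cmod D"
      using lm l1 by (auto simp: norm_mult mult_left_le_one_le)
    then have "l * \<psi> (cmod (c + m * D)) + m * \<psi> (cmod (c + (- (l * D))))
        \<le> l * (2 powr q * (\<tau> powr \<sigma> * \<psi> d)) + m * (2 powr q * (\<tau> powr \<sigma> * \<psi> d))"
      using lm by (intro add_mono mult_left_mono b) auto
    also have "\<dots> = (l + m) * (2 powr q * (\<tau> powr \<sigma> * \<psi> d))" by (simp only: distrib_right)
    also have "\<dots> = 2 powr q * (\<tau> powr \<sigma> * \<psi> d)" using lm by simp
    finally have "l * \<psi> (cmod (c + m * D)) + m * \<psi> (cmod (c - l * D)) \<le> 2 powr q * (\<tau> powr \<sigma> * \<psi> d)"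
      by simp
    moreover have "0 \<le> C1 * (\<tau> powr \<sigma> * (\<psi> (cmod c) + \<psi> d))" "0 \<le> 2 powr q * (\<tau> powr \<sigma> * \<psi> (cmod c))"
      using \<psi>_nonneg C1 by simp_all
    ultimately show ?thesis using \<psi>_nonneg[of "cmod c"] unfolding distrib_left distrib_right by linarith
  qed
  then show ?thesis by (simp add: C1_def smoothness_const_def mult.assoc)
qed

section \<open>Smoothness of the conjugate of a sum\<close>

lemma superlinear_add: "superlinear (\<lambda>x. \<Phi> x + \<phi> x)" if "young_function \<Phi>"
  by (rule superlinear_mono[OF superlinear]) (simp add: young_nonneg[OF that])

text \<open>The touching majorant at \<open>|a|\<close> reduces this to \<open>conjugate_smooth\<close> at a point \<open>c'\<close> of the segment
  from \<open>0\<close> to \<open>a\<close>.\<close>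

lemma conjugate_add_smooth:
  fixes a D :: complex and l m \<tau> d :: real
  assumes \<Phi>: "young_function \<Phi>"
    and lm: "0 \<le> l" "0 \<le> m" "l + m = 1"
    and D: "cmod D \<le> \<tau> * d" and \<tau>: "0 \<le> \<tau>" "\<tau> \<le> 1" and d: "0 \<le> d"
  defines "\<Psi> \<equiv> conjugate (\<lambda>x. \<Phi> x + \<phi> x)"
  shows "l * \<Psi> (cmod (a + m * D)) + m * \<Psi> (cmod (a - l * D))
      \<le> \<Psi> (cmod a) + smoothness_const * \<tau> powr \<sigma> * (\<psi> (cmod a) + \<psi> d)"
proof -
  obtain c where c: "0 \<le> c" "c \<le> cmod a"
    and touch: "\<And>y. \<Psi> (cmod a - c + y) \<le> \<Psi> (cmod a) - \<psi> c + \<psi> y"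
    using conjugate_add_touching[OF \<Phi> young superlinear norm_ge_zero[of a]] unfolding \<Psi>_def by blast
  define e where "e = (if a = 0 then 1 else sgn a)"
  have e: "cmod e = 1" "a = cmod a * e"
    by (simp_all add: e_def norm_sgn) (simp add: sgn_div_norm scaleR_conv_of_real)
  define c' where "c' = c * e"
  have c': "cmod c' = c" using c e by (simp add: c'_def norm_mult)
  have one: "\<Psi> (cmod (a + E)) \<le> \<Psi> (cmod a) - \<psi> c + \<psi> (cmod (c' + E))" for E
  proof -
    have "a + E = (cmod a - c) * e + (c' + E)"
      by (subst e(2)) (simp add: c'_def algebra_simps)
    then have "cmod (a + E) \<le> cmod ((cmod a - c) * e) + cmod (c' + E)"
      by (metis norm_triangle_ineq)
    also have "cmod ((cmod a - c) * e) = cmod a - c"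
      using c e(1) by (simp add: norm_mult flip: of_real_diff)
    finally have "\<Psi> (cmod (a + E)) \<le> \<Psi> (cmod a - c + cmod (c' + E))"
      unfolding \<Psi>_def by (rule conjugate_mono[OF superlinear_add[OF \<Phi>]])
    then show ?thesis using touch by (rule order_trans)
  qed
  have "l * \<Psi> (cmod (a + m * D)) + m * \<Psi> (cmod (a + (- (l * D))))
      \<le> l * (\<Psi> (cmod a) - \<psi> c + \<psi> (cmod (c' + m * D)))
        + m * (\<Psi> (cmod a) - \<psi> c + \<psi> (cmod (c' + (- (l * D)))))"
    using lm by (intro add_mono mult_left_mono one) auto
  also have "\<dots> = (l + m) * (\<Psi> (cmod a) - \<psi> c)
      + (l * \<psi> (cmod (c' + m * D)) + m * \<psi> (cmod (c' - l * D)))"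
    by (simp add: algebra_simps)
  also have "\<dots> \<le> (\<Psi> (cmod a) - \<psi> c)
      + (\<psi> (cmod c') + smoothness_const * \<tau> powr \<sigma> * (\<psi> (cmod c') + \<psi> d))"
    using conjugate_smooth[OF lm D \<tau> d, of c'] lm by simp
  also have "\<dots> = \<Psi> (cmod a) + smoothness_const * \<tau> powr \<sigma> * (\<psi> c + \<psi> d)"
    by (simp add: c')
  also have "\<dots> \<le> \<Psi> (cmod a) + smoothness_const * \<tau> powr \<sigma> * (\<psi> (cmod a) + \<psi> d)"
    using smoothness_const_nonneg \<psi>_mono[OF c(2)] by (intro add_left_mono mult_left_mono) auto
  finally show ?thesis by simp
qed

text \<open>If \<open>\<phi>\<close> dominates the sum up to constants, its conjugate is controlled by that of the sum; the dilation by
  \<open>B\<close> that appears is undone by \<open>conjugate_expand\<close>.\<close>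

lemma conjugate_le_conjugate_add:
  assumes \<Phi>: "young_function \<Phi>" and B: "1 \<le> B"
    and dom: "\<And>x. 0 \<le> x \<Longrightarrow> \<Phi> x + \<phi> x \<le> B * \<phi> x + K" and y: "0 \<le> y"
  shows "\<psi> y \<le> B powr q * (conjugate (\<lambda>x. \<Phi> x + \<phi> x) y + K)"
proof -
  let ?\<Psi> = "conjugate (\<lambda>x. \<Phi> x + \<phi> x)"
  have *: "\<psi> (y / B) \<le> (?\<Psi> y + K) / B"
  proof (rule conjugate_least)
    fix x :: real assume x: "0 \<le> x"
    have "x * y - (\<Phi> x + \<phi> x) \<le> ?\<Psi> y"
      by (rule conjugate_upper[OF superlinear_add[OF \<Phi>] x])
    then have "x * y - B * \<phi> x \<le> ?\<Psi> y + K" using dom[OF x] by linarith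
    then have "(x * y - B * \<phi> x) / B \<le> (?\<Psi> y + K) / B" using B by (intro divide_right_mono) auto
    then show "x * (y / B) - \<phi> x \<le> (?\<Psi> y + K) / B" using B by (simp add: diff_divide_distrib)
  qed
  also have "(?\<Psi> y + K) / B \<le> ?\<Psi> y + K"
  proof -
    have "0 \<le> (?\<Psi> y + K) / B" using * \<psi>_nonneg[of "y / B"] by linarith
    then have "0 \<le> ?\<Psi> y + K" using B by (simp add: zero_le_divide_iff)
    then show ?thesis using B by (simp add: divide_le_eq mult_left_le mult_le_cancel_left1)
  qed
  finally have "B powr q * \<psi> (y / B) \<le> B powr q * (?\<Psi> y + K)" by (rule mult_left_mono) simp
  moreover have "\<psi> y \<le> B powr q * \<psi> (y / B)"
    using conjugate_expand[OF B, of "y / B"] B y by simp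
  ultimately show ?thesis by linarith
qed

text \<open>With \<open>u\<^sub>1\<close>, \<open>u\<^sub>2\<close> the two dilated functions, the weights \<open>t\<^sub>1 / (t\<^sub>1 + t\<^sub>2)\<close> and \<open>t\<^sub>2 / (t\<^sub>1 + t\<^sub>2)\<close> are the ones that
  eliminate \<open>h\<^sub>2\<close> from the mean, which becomes \<open>2 h\<^sub>1 / (t\<^sub>1 + t\<^sub>2)\<close>. The difference \<open>u\<^sub>1 - u\<^sub>2\<close> is of order \<open>\<tau>\<close> since
  \<open>|t\<^sub>1 - t\<^sub>2| \<le> 2 \<tau>\<close>.\<close>

lemma dilated_pair_estimate:
  fixes h1 h2 :: complex and \<tau> t1 t2 :: real
  assumes \<Phi>: "young_function \<Phi>" and \<tau>: "0 \<le> \<tau>" "\<tau> \<le> 1 / 2"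
    and t1: "1 - \<tau> \<le> t1" "t1 \<le> 1 + \<tau>" and t2: "1 - \<tau> \<le> t2" "t2 \<le> 1 + \<tau>" and t: "2 \<le> t1 + t2"
  defines "\<Psi> \<equiv> conjugate (\<lambda>x. \<Phi> x + \<phi> x)"
  shows "t1 / (t1 + t2) * \<Psi> (cmod ((h1 + \<tau> * h2) / t1)) + t2 / (t1 + t2) * \<Psi> (cmod ((h1 - \<tau> * h2) / t2))
      \<le> 2 / (t1 + t2) * \<Psi> (cmod h1)
        + smoothness_const * (1 + 16 powr q) * \<tau> powr \<sigma> * (\<psi> (cmod h1) + \<psi> (cmod h2))"
proof -
  define l m where "l = t1 / (t1 + t2)" and "m = t2 / (t1 + t2)"
  have pos: "1/2 \<le> t1" "1/2 \<le> t2" using \<tau> t1 t2 by linarith+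
  have lm: "0 \<le> l" "0 \<le> m" "l + m = 1"
    using pos by (auto simp: l_def m_def simp flip: add_divide_distrib)
  define u1 u2 where "u1 = (h1 + \<tau> * h2) / t1" and "u2 = (h1 - \<tau> * h2) / t2"
  define a D where "a = (2 / (t1 + t2)) * h1" and "D = u1 - u2"
  have a: "a = l * u1 + m * u2"
  proof -
    have "l * u1 = (h1 + \<tau> * h2) / (t1 + t2)" "m * u2 = (h1 - \<tau> * h2) / (t1 + t2)"
      using pos by (simp_all add: l_def m_def u1_def u2_def)
    then show ?thesis by (simp add: a_def flip: add_divide_distrib)
  qed
  have l: "complex_of_real l = 1 - m" using lm by (simp add: algebra_simps flip: of_real_add)
  have u: "a + m * D = u1" "a - l * D = u2"
    unfolding a D_def l by (simp_all add: algebra_simps)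
  \<comment> \<open>\<open>8 (|h1| + |h2|)\<close>, written as a multiple of a mean so that \<open>\<psi> d\<close> can be split.\<close>
  define d where "d = 16 * ((cmod h1 + cmod h2) / 2)"
  have D: "cmod D \<le> \<tau> * d"
  proof -
    have inv: "1 / t1 \<le> 2" "1 / t2 \<le> 2" using pos by (simp_all add: field_simps)
    have "D = h1 * complex_of_real (1 / t1 - 1 / t2) + h2 * complex_of_real (\<tau> * (1 / t1 + 1 / t2))"
      by (simp add: D_def u1_def u2_def field_simps diff_divide_distrib add_divide_distrib)
    then have "cmod D \<le> cmod h1 * \<bar>1 / t1 - 1 / t2\<bar> + cmod h2 * \<bar>\<tau> * (1 / t1 + 1 / t2)\<bar>"
      by (metis norm_triangle_ineq norm_mult norm_of_real)
    also have "1 / t1 - 1 / t2 = (t2 - t1) * (1 / t1 * (1 / t2))"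
      using pos by (simp add: field_simps)
    also have "\<bar>(t2 - t1) * (1 / t1 * (1 / t2))\<bar> \<le> (2 * \<tau>) * (2 * 2)"
      unfolding abs_mult using inv pos t1 t2 by (intro mult_mono) auto
    also have "\<bar>\<tau> * (1 / t1 + 1 / t2)\<bar> \<le> \<tau> * (2 + 2)"
      using inv pos \<tau> by (simp add: abs_mult mult_left_mono)
    finally have "cmod D \<le> cmod h1 * (2 * \<tau> * (2 * 2)) + cmod h2 * (\<tau> * (2 + 2))"
      by (simp add: mult_left_mono add_mono)
    also have "\<dots> \<le> \<tau> * d" using \<tau> by (simp add: d_def algebra_simps)
    finally show ?thesis .
  qed
  have d0: "0 \<le> d" by (simp add: d_def)
  have "l * \<Psi> (cmod (a + m * D)) + m * \<Psi> (cmod (a - l * D))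
      \<le> \<Psi> (cmod a) + smoothness_const * \<tau> powr \<sigma> * (\<psi> (cmod a) + \<psi> d)"
    unfolding \<Psi>_def using \<tau> by (intro conjugate_add_smooth[OF \<Phi> lm D _ _ d0]) auto
  also have "\<Psi> (cmod a) \<le> 2 / (t1 + t2) * \<Psi> (cmod h1)"
  proof -
    have "cmod a = (2 / (t1 + t2)) * cmod h1"
      unfolding a_def norm_mult norm_of_real using t by simp
    then show ?thesis unfolding \<Psi>_def
      using conjugate_shrink[OF superlinear_add[OF \<Phi>], of "2 / (t1 + t2)" "cmod h1"] t zero \<Phi>
        young_nonneg[OF \<Phi>] nonneg by (simp add: young_function_def)
  qed
  also have "smoothness_const * \<tau> powr \<sigma> * (\<psi> (cmod a) + \<psi> d)
      \<le> smoothness_const * \<tau> powr \<sigma> * ((1 + 16 powr q) * (\<psi> (cmod h1) + \<psi> (cmod h2)))"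
  proof (intro mult_left_mono)
    have "cmod a = (2 / (t1 + t2)) * cmod h1"
      unfolding a_def norm_mult norm_of_real using t by simp
    also have "\<dots> \<le> cmod h1" using t by (intro mult_left_le_one_le) auto
    finally have "\<psi> (cmod a) \<le> \<psi> (cmod h1)" by (rule \<psi>_mono)
    moreover have "\<psi> d \<le> 16 powr q * \<psi> ((cmod h1 + cmod h2) / 2)"
      unfolding d_def by (intro conjugate_expand) auto
    moreover have "\<psi> ((cmod h1 + cmod h2) / 2) \<le> \<psi> (cmod h1) + \<psi> (cmod h2)"
    proof (cases "cmod h1 \<le> cmod h2")
      case True
      then have "\<psi> ((cmod h1 + cmod h2) / 2) \<le> \<psi> (cmod h2)" by (intro \<psi>_mono) simp
      then show ?thesis using \<psi>_nonneg[of "cmod h1"] by linarith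
    next
      case False
      then have "\<psi> ((cmod h1 + cmod h2) / 2) \<le> \<psi> (cmod h1)" by (intro \<psi>_mono) simp
      then show ?thesis using \<psi>_nonneg[of "cmod h2"] by linarith
    qed
    then have "16 powr q * \<psi> ((cmod h1 + cmod h2) / 2) \<le> 16 powr q * (\<psi> (cmod h1) + \<psi> (cmod h2))"
      by (rule mult_left_mono) simp
    ultimately have "\<psi> (cmod a) \<le> \<psi> (cmod h1) + \<psi> (cmod h2)"
      "\<psi> d \<le> 16 powr q * (\<psi> (cmod h1) + \<psi> (cmod h2))"
      using \<psi>_nonneg[of "cmod h2"] by (linarith, meson order_trans)
    then show "\<psi> (cmod a) + \<psi> d \<le> (1 + 16 powr q) * (\<psi> (cmod h1) + \<psi> (cmod h2))"
      unfolding distrib_right mult_1_left by (rule add_mono)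
  qed (use smoothness_const_nonneg in auto)
  finally show ?thesis unfolding u by (simp add: l_def m_def u1_def u2_def mult.assoc mult.left_commute)
qed

end

section \<open>From smoothness of the modular to the norm inequality\<close>

text \<open>The constant \<open>K\<close> allows \<open>\<Phi>\<close> to be much larger than \<open>\<phi>\<close> near \<open>0\<close>; its integral is bounded by \<open>\<kappa>\<close>,
  so that \<open>K = 0\<close> if the measure is infinite.\<close>

locale perturbed = power_type +
  fixes \<Phi> :: "real \<Rightarrow> real" and M :: "'a measure" and B K \<kappa> :: real
  assumes \<Phi>: "young_function \<Phi>" and B: "1 \<le> B"
    and dominated: "\<And>x. 0 \<le> x \<Longrightarrow> \<Phi> x + \<phi> x \<le> B * \<phi> x + K"
    and K: "0 \<le> K" "0 \<le> \<kappa>" "(\<integral>\<^sup>+x. ennreal K \<partial>M) \<le> ennreal \<kappa>"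
begin

abbreviation \<Psi> :: "real \<Rightarrow> real" where "\<Psi> \<equiv> conjugate (\<lambda>x. \<Phi> x + \<phi> x)"

abbreviation modular :: "('a \<Rightarrow> complex) \<Rightarrow> ennreal" where
  "modular h \<equiv> \<integral>\<^sup>+x. ennreal (\<Psi> (cmod (h x))) \<partial>M"

lemma \<Phi>_0: "\<Phi> 0 = 0"
  using \<Phi> by (simp add: young_function_def)

lemma \<Psi>_mono: "y \<le> z \<Longrightarrow> \<Psi> y \<le> \<Psi> z"
  by (rule conjugate_mono[OF superlinear_add[OF \<Phi>]])

lemma \<Psi>_nonneg: "0 \<le> \<Psi> y"
  by (rule conjugate_nonneg[OF superlinear_add[OF \<Phi>]]) (simp add: zero \<Phi>_0)

lemma \<Psi>_measurable [measurable]: "\<Psi> \<in> borel_measurable borel"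
  by (rule borel_measurable_mono) (simp add: mono_def \<Psi>_mono)

definition modular_const :: real where
  "modular_const = smoothness_const * (1 + 16 powr q) * B powr q * (2 + 2 * \<kappa>)"

lemma modular_const_nonneg: "0 \<le> modular_const"
  using smoothness_const_nonneg K by (simp add: modular_const_def)

text \<open>Smoothness of the modular: if both \<open>h\<^sub>1 + \<tau> h\<^sub>2\<close> and \<open>h\<^sub>1 - \<tau> h\<^sub>2\<close> still have modular at least \<open>1\<close> after division by
  \<open>t\<^sub>1\<close> and \<open>t\<^sub>2\<close>, then the average of \<open>t\<^sub>1\<close> and \<open>t\<^sub>2\<close> is at most \<open>1 + O(\<tau>\<^sup>\<sigma>)\<close>. One integrates
  \<open>dilated_pair_estimate\<close>.\<close>

lemma dilation_bound:
  assumes [measurable]: "h1 \<in> borel_measurable M" "h2 \<in> borel_measurable M"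
    and h: "modular h1 \<le> 1" "modular h2 \<le> 1"
    and \<tau>: "0 \<le> \<tau>" "\<tau> \<le> 1 / 2"
    and t1: "1 - \<tau> \<le> t1" "t1 \<le> 1 + \<tau>" and t2: "1 - \<tau> \<le> t2" "t2 \<le> 1 + \<tau>" and t: "2 \<le> t1 + t2"
    and big: "1 \<le> modular (\<lambda>x. (h1 x + \<tau> * h2 x) / t1)" "1 \<le> modular (\<lambda>x. (h1 x - \<tau> * h2 x) / t2)"
  shows "1 \<le> 2 / (t1 + t2) + modular_const * \<tau> powr \<sigma>"
proof -
  define l m where "l = t1 / (t1 + t2)" and "m = t2 / (t1 + t2)"
  have pos: "1/2 \<le> t1" "1/2 \<le> t2" using \<tau> t1 t2 by linarith+
  have lm: "0 \<le> l" "0 \<le> m" "l + m = 1"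
    using pos by (auto simp: l_def m_def simp flip: add_divide_distrib)
  define r where "r = 2 / (t1 + t2)"
  have r: "0 \<le> r" using t by (simp add: r_def)
  define C where "C = smoothness_const * (1 + 16 powr q) * B powr q * \<tau> powr \<sigma>"
  have C: "0 \<le> C" using smoothness_const_nonneg by (simp add: C_def)
  have pw: "l * \<Psi> (cmod ((h1 x + \<tau> * h2 x) / t1)) + m * \<Psi> (cmod ((h1 x - \<tau> * h2 x) / t2))
      \<le> r * \<Psi> (cmod (h1 x)) + C * (\<Psi> (cmod (h1 x)) + \<Psi> (cmod (h2 x)) + 2 * K)" for x
  proof -
    have "\<psi> (cmod (h1 x)) + \<psi> (cmod (h2 x))
        \<le> B powr q * (\<Psi> (cmod (h1 x)) + K) + B powr q * (\<Psi> (cmod (h2 x)) + K)"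
      by (rule add_mono; rule conjugate_le_conjugate_add[OF \<Phi> B dominated]) auto
    then have "smoothness_const * (1 + 16 powr q) * \<tau> powr \<sigma> * (\<psi> (cmod (h1 x)) + \<psi> (cmod (h2 x)))
        \<le> smoothness_const * (1 + 16 powr q) * \<tau> powr \<sigma>
          * (B powr q * (\<Psi> (cmod (h1 x)) + K) + B powr q * (\<Psi> (cmod (h2 x)) + K))"
      using smoothness_const_nonneg by (intro mult_left_mono) auto
    also have "\<dots> = C * (\<Psi> (cmod (h1 x)) + \<Psi> (cmod (h2 x)) + 2 * K)"
      by (simp add: C_def algebra_simps)
    finally show ?thesis
      using dilated_pair_estimate[OF \<Phi> \<tau> t1 t2 t, of "h1 x" "h2 x"]
      unfolding l_def m_def r_def by linarith
  qed
  have "1 = ennreal l * 1 + ennreal m * 1"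
    using lm by (simp flip: ennreal_plus)
  also have "\<dots> \<le> ennreal l * modular (\<lambda>x. (h1 x + \<tau> * h2 x) / t1)
      + ennreal m * modular (\<lambda>x. (h1 x - \<tau> * h2 x) / t2)"
    using big by (intro add_mono mult_left_mono) auto
  also have "\<dots> = (\<integral>\<^sup>+x. ennreal (l * \<Psi> (cmod ((h1 x + \<tau> * h2 x) / t1))
      + m * \<Psi> (cmod ((h1 x - \<tau> * h2 x) / t2))) \<partial>M)"
    using lm by (simp add: nn_integral_add nn_integral_cmult ennreal_plus ennreal_mult \<Psi>_nonneg)
  also have "\<dots> \<le> (\<integral>\<^sup>+x. ennreal (r * \<Psi> (cmod (h1 x))
      + C * (\<Psi> (cmod (h1 x)) + \<Psi> (cmod (h2 x)) + 2 * K)) \<partial>M)"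
    by (intro nn_integral_mono ennreal_leI pw)
  also have "\<dots> = ennreal r * modular h1
      + ennreal C * (modular h1 + modular h2 + 2 * (\<integral>\<^sup>+x. ennreal K \<partial>M))"
    using r C K by (simp add: nn_integral_add nn_integral_cmult ennreal_plus ennreal_mult \<Psi>_nonneg mult.assoc)
  also have "\<dots> \<le> ennreal r * 1 + ennreal C * (1 + 1 + 2 * ennreal \<kappa>)"
    using h K by (intro add_mono mult_left_mono) auto
  also have "\<dots> = ennreal (r + C * (2 + 2 * \<kappa>))"
  proof -
    have "1 + 1 + 2 * ennreal \<kappa> = ennreal (2 + 2 * \<kappa>)"
      using K by (simp add: ennreal_plus ennreal_mult)
    then show ?thesis using r C K by (simp add: ennreal_plus ennreal_mult)
  qed
  finally have "1 \<le> r + C * (2 + 2 * \<kappa>)"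
    by (simp only: ennreal_ge_1)
  then show ?thesis by (simp add: r_def C_def modular_const_def mult_ac)
qed

lemma pairing_le_dilation:
  assumes [measurable]: "F \<in> borel_measurable M" "H \<in> borel_measurable M"
    and N: "0 \<le> N" "\<And>h. h \<in> borel_measurable M \<Longrightarrow> modular h \<le> 1 \<Longrightarrow> (\<integral>\<^sup>+x. ennreal (cmod (F x * h x)) \<partial>M) \<le> ennreal N"
    and t: "0 < t" "modular (\<lambda>x. H x / complex_of_real t) \<le> 1"
  shows "(\<integral>\<^sup>+x. ennreal (cmod (F x * H x)) \<partial>M) \<le> ennreal (t * N)"
proof -
  have "(\<integral>\<^sup>+x. ennreal (cmod (F x * H x)) \<partial>M)
      = (\<integral>\<^sup>+x. ennreal t * ennreal (cmod (F x * (H x / complex_of_real t))) \<partial>M)"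
    using t(1) by (intro nn_integral_cong) (simp add: norm_mult norm_divide flip: ennreal_mult)
  also have "\<dots> = ennreal t * (\<integral>\<^sup>+x. ennreal (cmod (F x * (H x / complex_of_real t))) \<partial>M)"
    by (rule nn_integral_cmult) measurable
  also have "\<dots> \<le> ennreal t * ennreal N"
    using t by (intro mult_left_mono N) auto
  finally show ?thesis using t N by (simp add: ennreal_mult)
qed

text \<open>A crude bound for the size of \<open>h\<^sub>1 \<plusminus> \<tau> h\<^sub>2\<close>, by convexity alone. It confines the dilation
  factors to the range \<open>[1 - \<tau>, 1 + \<tau>]\<close> that \<open>dilation_bound\<close> requires.\<close>

lemma modular_perturbation:
  assumes [measurable]: "h1 \<in> borel_measurable M" "h2 \<in> borel_measurable M"
    and h: "modular h1 \<le> 1" "modular h2 \<le> 1" and \<tau>: "0 \<le> \<tau>"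
    and H: "\<And>x. cmod (H x) \<le> cmod (h1 x) + \<tau> * cmod (h2 x)"
  shows "modular (\<lambda>x. H x / complex_of_real (1 + \<tau>)) \<le> 1"
proof -
  define l m where "l = 1 / (1 + \<tau>)" and "m = \<tau> / (1 + \<tau>)"
  have lm: "0 \<le> l" "0 \<le> m" "l + m = 1"
    using \<tau> by (auto simp: l_def m_def simp flip: add_divide_distrib)
  have "modular (\<lambda>x. H x / complex_of_real (1 + \<tau>))
      \<le> (\<integral>\<^sup>+x. ennreal (l * \<Psi> (cmod (h1 x)) + m * \<Psi> (cmod (h2 x))) \<partial>M)"
  proof (intro nn_integral_mono ennreal_leI)
    fix x
    have "cmod (H x / complex_of_real (1 + \<tau>)) = cmod (H x) / (1 + \<tau>)"
      unfolding norm_divide norm_of_real using \<tau> by simp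
    also have "\<dots> \<le> (cmod (h1 x) + \<tau> * cmod (h2 x)) / (1 + \<tau>)"
      using H \<tau> by (intro divide_right_mono) auto
    also have "\<dots> = l * cmod (h1 x) + m * cmod (h2 x)"
      by (simp add: l_def m_def add_divide_distrib)
    finally have "\<Psi> (cmod (H x / complex_of_real (1 + \<tau>))) \<le> \<Psi> (l * cmod (h1 x) + m * cmod (h2 x))"
      by (rule \<Psi>_mono)
    also have "\<dots> \<le> l * \<Psi> (cmod (h1 x)) + m * \<Psi> (cmod (h2 x))"
      by (rule conjugate_convex[OF superlinear_add[OF \<Phi>] lm])
    finally show "\<Psi> (cmod (H x / complex_of_real (1 + \<tau>))) \<le> l * \<Psi> (cmod (h1 x)) + m * \<Psi> (cmod (h2 x))" .
  qed
  also have "\<dots> = ennreal l * modular h1 + ennreal m * modular h2"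
    using lm by (simp add: nn_integral_add nn_integral_cmult ennreal_plus ennreal_mult \<Psi>_nonneg)
  also have "\<dots> \<le> ennreal l * 1 + ennreal m * 1"
    using h by (intro add_mono mult_left_mono) auto
  also have "\<dots> = 1" using lm by (simp flip: ennreal_plus)
  finally show ?thesis .
qed

text \<open>The dilation factors are chosen as \<open>t\<^sub>1 = \<rho> u / N\<close> and \<open>t\<^sub>2 = \<rho> v / N\<close>, where \<open>u\<close> and \<open>v\<close> are the pairings of \<open>f + g\<close>
  with \<open>h\<^sub>1 + \<tau> h\<^sub>2\<close> and of \<open>f - g\<close> with \<open>h\<^sub>1 - \<tau> h\<^sub>2\<close>, and \<open>\<rho> < 1\<close>. A function of modular at most \<open>1\<close> after
  division by \<open>t\<close> has pairing at most \<open>t N\<close>, so both divided functions must have modular above \<open>1\<close>,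
  and \<open>dilation_bound\<close> limits \<open>u + v\<close>. This replaces the dual (Luxemburg) norm of \<open>h\<^sub>1 \<plusminus> \<tau> h\<^sub>2\<close>, and with it
  the question of whether that norm is attained. The sum \<open>u + v\<close> bounds twice the pairing of \<open>f\<close> with \<open>h\<^sub>1\<close> plus \<open>\<tau>\<close>
  times that of \<open>g\<close> with \<open>h\<^sub>2\<close>, by the parallelogram identity for products.\<close>

lemma aligned_pairing_bound:
  assumes [measurable]: "f \<in> borel_measurable M" "g \<in> borel_measurable M"
      "h1 \<in> borel_measurable M" "h2 \<in> borel_measurable M"
    and h: "modular h1 \<le> 1" "modular h2 \<le> 1"
    and aligned: "\<And>x. f x * h1 x = complex_of_real (cmod (f x * h1 x))"
      "\<And>x. g x * h2 x = complex_of_real (cmod (g x * h2 x))"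
    and N: "0 \<le> N"
      "\<And>h. h \<in> borel_measurable M \<Longrightarrow> modular h \<le> 1 \<Longrightarrow> (\<integral>\<^sup>+x. ennreal (cmod ((f x + g x) * h x)) \<partial>M) \<le> ennreal N"
      "\<And>h. h \<in> borel_measurable M \<Longrightarrow> modular h \<le> 1 \<Longrightarrow> (\<integral>\<^sup>+x. ennreal (cmod ((f x - g x) * h x)) \<partial>M) \<le> ennreal N"
    and \<tau>: "0 \<le> \<tau>" "\<tau> \<le> 1 / 2" "modular_const * \<tau> powr \<sigma> \<le> 1 / 2"
  shows "(\<integral>\<^sup>+x. ennreal (cmod (f x * h1 x)) \<partial>M) + ennreal \<tau> * (\<integral>\<^sup>+x. ennreal (cmod (g x * h2 x)) \<partial>M)
      \<le> ennreal (N * (1 + 2 * (modular_const * \<tau> powr \<sigma>)))"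
proof -
  define H1 H2 where "H1 x = h1 x + \<tau> * h2 x" and "H2 x = h1 x - \<tau> * h2 x" for x
  have [measurable]: "H1 \<in> borel_measurable M" "H2 \<in> borel_measurable M"
    unfolding H1_def H2_def by measurable
  define P Q where "P = (\<integral>\<^sup>+x. ennreal (cmod ((f x + g x) * H1 x)) \<partial>M)"
    and "Q = (\<integral>\<^sup>+x. ennreal (cmod ((f x - g x) * H2 x)) \<partial>M)"
  have t\<tau>: "0 < 1 + \<tau>" using \<tau> by simp
  have Hle: "cmod (H1 x) \<le> cmod (h1 x) + \<tau> * cmod (h2 x)" "cmod (H2 x) \<le> cmod (h1 x) + \<tau> * cmod (h2 x)" for x
    using norm_triangle_ineq[of "h1 x" "\<tau> * h2 x"] norm_triangle_ineq4[of "h1 x" "\<tau> * h2 x"] \<tau>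
    by (simp_all add: H1_def H2_def norm_mult)
  have P: "P \<le> ennreal ((1 + \<tau>) * N)" unfolding P_def
    using Hle by (intro pairing_le_dilation modular_perturbation[OF _ _ h \<tau>(1)] N t\<tau>) auto
  have Q: "Q \<le> ennreal ((1 + \<tau>) * N)" unfolding Q_def
    using Hle by (intro pairing_le_dilation modular_perturbation[OF _ _ h \<tau>(1)] N t\<tau>) auto
  have N\<tau>: "0 \<le> (1 + \<tau>) * N" using N(1) \<tau> by simp
  obtain u where u: "P = ennreal u" "0 \<le> u" "u \<le> (1 + \<tau>) * N"
    using P N\<tau> by (cases P) (auto simp: top_unique)
  obtain v where v: "Q = ennreal v" "0 \<le> v" "v \<le> (1 + \<tau>) * N"
    using Q N\<tau> by (cases Q) (auto simp: top_unique)
  define E where "E = 1 + 2 * (modular_const * \<tau> powr \<sigma>)"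
  have E1: "1 \<le> E" using modular_const_nonneg by (simp add: E_def)
  have uv: "u + v \<le> 2 * (N * E)"
  proof (rule ccontr)
    assume "\<not> ?thesis"
    then have big: "2 * (N * E) < u + v" by simp
    have "0 < N"
    proof (rule ccontr)
      assume "\<not> 0 < N"
      then have "N = 0" using N(1) by simp
      then show False using big u(3) v(3) by simp
    qed
    \<comment> \<open>Any \<open>\<rho>\<close> strictly between \<open>r\<close> and \<open>1\<close> makes \<open>t1 + t2\<close> exceed \<open>2 E\<close> and keeps
      \<open>t1 N < u\<close> and \<open>t2 N < v\<close>.\<close>
    define r where "r = 2 * (N * E) / (u + v)"
    have "0 < u + v" using big N E1 \<open>0 < N\<close> by (smt (verit) mult_nonneg_nonneg)
    then have r: "0 < r" "r < 1" using big \<open>0 < N\<close> E1 by (auto simp: r_def)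
    define \<rho> where "\<rho> = (1 + r) / 2"
    have \<rho>: "r < \<rho>" "\<rho> < 1" "0 < \<rho>" using r by (auto simp: \<rho>_def)
    define t1 t2 where "t1 = \<rho> * u / N" and "t2 = \<rho> * v / N"
    have sum: "2 * E < t1 + t2"
    proof -
      have "2 * (N * E) = r * (u + v)" using \<open>0 < u + v\<close> by (simp add: r_def)
      also have "\<dots> < \<rho> * (u + v)" using \<rho> \<open>0 < u + v\<close> by simp
      finally show ?thesis using \<open>0 < N\<close> by (simp add: t1_def t2_def field_simps)
    qed
    have t_le: "t1 \<le> 1 + \<tau>" "t2 \<le> 1 + \<tau>"
    proof -
      have "\<rho> * u \<le> 1 * ((1 + \<tau>) * N)" using \<rho> u by (intro mult_mono) auto
      then show "t1 \<le> 1 + \<tau>" using \<open>0 < N\<close> by (simp add: t1_def divide_le_eq)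
      have "\<rho> * v \<le> 1 * ((1 + \<tau>) * N)" using \<rho> v by (intro mult_mono) auto
      then show "t2 \<le> 1 + \<tau>" using \<open>0 < N\<close> by (simp add: t2_def divide_le_eq)
    qed
    have t_ge: "1 - \<tau> \<le> t1" "1 - \<tau> \<le> t2" using t_le sum E1 by linarith+
    have t_pos: "0 < t1" "0 < t2" using t_ge \<tau> by linarith+
    have "t1 * N < u" "t2 * N < v"
      using t_pos \<open>0 < N\<close> \<rho> by (auto simp: t1_def t2_def zero_less_divide_iff zero_less_mult_iff)
    have m1: "1 \<le> modular (\<lambda>x. (h1 x + \<tau> * h2 x) / t1)"
    proof (rule ccontr)
      assume "\<not> ?thesis"
      then have "P \<le> ennreal (t1 * N)" unfolding P_def
        by (intro pairing_le_dilation N t_pos) (auto simp: H1_def)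
      then show False using \<open>t1 * N < u\<close> u t_pos N by (simp add: ennreal_le_iff)
    qed
    have m2: "1 \<le> modular (\<lambda>x. (h1 x - \<tau> * h2 x) / t2)"
    proof (rule ccontr)
      assume "\<not> ?thesis"
      then have "Q \<le> ennreal (t2 * N)" unfolding Q_def
        by (intro pairing_le_dilation N t_pos) (auto simp: H2_def)
      then show False using \<open>t2 * N < v\<close> v t_pos N by (simp add: ennreal_le_iff)
    qed
    define y where "y = modular_const * \<tau> powr \<sigma>"
    have y: "0 \<le> y" "y \<le> 1 / 2" "E = 1 + 2 * y"
      using modular_const_nonneg \<tau> by (auto simp: y_def E_def)
    have "1 \<le> 2 / (t1 + t2) + y" unfolding y_def
      using sum E1 t_le t_ge \<tau> h m1 m2 by (intro dilation_bound) auto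
    moreover have "2 / (t1 + t2) < 1 / E"
      using sum E1 by (simp add: field_simps)
    moreover have "1 / E \<le> 1 - y"
    proof -
      have "y * y \<le> y * (1 / 2)" using y by (intro mult_left_mono) auto
      then have "1 \<le> (1 - y) * E" unfolding y(3) by (simp add: algebra_simps)
      then show ?thesis using E1 by (simp add: divide_le_eq)
    qed
    ultimately show False by linarith
  qed
  have "2 * ((\<integral>\<^sup>+x. ennreal (cmod (f x * h1 x)) \<partial>M) + ennreal \<tau> * (\<integral>\<^sup>+x. ennreal (cmod (g x * h2 x)) \<partial>M))
      = (\<integral>\<^sup>+x. ennreal (2 * (cmod (f x * h1 x) + \<tau> * cmod (g x * h2 x))) \<partial>M)"
    using \<tau> by (simp add: nn_integral_add nn_integral_cmult ennreal_plus ennreal_mult distrib_left)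
  also have "\<dots> \<le> (\<integral>\<^sup>+x. ennreal (cmod ((f x + g x) * H1 x) + cmod ((f x - g x) * H2 x)) \<partial>M)"
  proof (intro nn_integral_mono ennreal_leI)
    fix x
    have "complex_of_real (2 * (cmod (f x * h1 x) + \<tau> * cmod (g x * h2 x)))
        = 2 * (f x * h1 x + \<tau> * (g x * h2 x))"
      using aligned[of x] by (metis of_real_add of_real_mult of_real_numeral)
    also have "\<dots> = (f x + g x) * H1 x + (f x - g x) * H2 x"
      by (simp add: H1_def H2_def algebra_simps)
    finally have "cmod (complex_of_real (2 * (cmod (f x * h1 x) + \<tau> * cmod (g x * h2 x))))
        \<le> cmod ((f x + g x) * H1 x) + cmod ((f x - g x) * H2 x)"
      by (metis norm_triangle_ineq)
    then show "2 * (cmod (f x * h1 x) + \<tau> * cmod (g x * h2 x))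
        \<le> cmod ((f x + g x) * H1 x) + cmod ((f x - g x) * H2 x)"
      unfolding norm_of_real by linarith
  qed
  also have "\<dots> = P + Q" unfolding P_def Q_def by (simp add: nn_integral_add ennreal_plus)
  also have "\<dots> = ennreal (u + v)" using u v by (simp add: ennreal_plus)
  also have "\<dots> \<le> ennreal (2 * (N * E))" using uv by (rule ennreal_leI)
  also have "\<dots> = 2 * ennreal (N * E)" by (simp add: ennreal_mult')
  finally show ?thesis unfolding E_def[symmetric]
    by (subst (asm) ennreal_mult_le_mult_iff) auto
qed

text \<open>The modular sees only absolute values, so a test function may be multiplied by a unimodular factor
  that makes its product with \<open>f\<close> nonnegative.\<close>

lemma align_phase:
  assumes [measurable]: "f \<in> borel_measurable M" "h \<in> borel_measurable M" and h: "modular h \<le> 1"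
  shows "\<exists>k\<in>borel_measurable M. modular k \<le> 1 \<and> (\<forall>x. f x * k x = complex_of_real (cmod (f x * h x)))"
proof -
  \<comment> \<open>Where \<open>f h = 0\<close> the quotient is \<open>0\<close>, which only decreases the modular.\<close>
  define k where "k x = h x * (cnj (f x * h x) / complex_of_real (cmod (f x * h x)))" for x
  have [measurable]: "cnj \<in> borel_measurable borel"
    by (intro borel_measurable_continuous_onI continuous_intros)
  have k_meas: "k \<in> borel_measurable M" unfolding k_def by measurable
  have fk: "f x * k x = complex_of_real (cmod (f x * h x))" for x
  proof -
    have "f x * k x = (f x * h x) * cnj (f x * h x) / complex_of_real (cmod (f x * h x))"
      by (simp add: k_def)
    also have "(f x * h x) * cnj (f x * h x) = complex_of_real (cmod (f x * h x)) * complex_of_real (cmod (f x * h x))"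
      by (metis complex_norm_square of_real_mult power2_eq_square)
    finally show ?thesis by simp
  qed
  have "cmod (k x) \<le> cmod (h x)" for x
  proof (cases "f x * h x = 0")
    case False
    then have "cmod (cnj (f x * h x) / complex_of_real (cmod (f x * h x))) = 1"
      unfolding norm_divide complex_mod_cnj norm_of_real by simp
    then show ?thesis unfolding k_def norm_mult[of "h x"] by simp
  qed (auto simp: k_def)
  then have "modular k \<le> modular h"
    by (intro nn_integral_mono ennreal_leI \<Psi>_mono)
  then have "modular k \<le> 1" using h by (rule order_trans)
  with k_meas fk show ?thesis by blast
qed

lemma complementary_eq: "complementary (\<lambda>x. \<Phi> x + \<phi> x) y = ennreal (\<Psi> y)"
  by (rule complementary_eq_conjugate[OF superlinear_add[OF \<Phi>]]) (simp add: zero \<Phi>_0)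

lemma orlicz_ennorm_eq:
  "orlicz_ennorm M (\<lambda>x. \<Phi> x + \<phi> x) f
    = (SUP h\<in>{h \<in> borel_measurable M. modular h \<le> 1}. \<integral>\<^sup>+x. ennreal (cmod (f x * h x)) \<partial>M)"
  unfolding orlicz_ennorm_def complementary_eq ..

lemma zero_admissible: "(\<lambda>x. 0) \<in> {h \<in> borel_measurable M. modular h \<le> 1}"
proof -
  have "\<Psi> 0 = 0"
    using young_nonneg[OF \<Phi>] nonneg
    by (intro conjugate_0[OF superlinear_add[OF \<Phi>]]) (simp_all add: zero \<Phi>_0)
  then show ?thesis by simp
qed

text \<open>The two test functions in \<open>aligned_pairing_bound\<close> are independent of each other, so one may take the supremum over
  each of them separately.\<close>

lemma weak_norm_inequality:
  assumes [measurable]: "f \<in> borel_measurable M" "g \<in> borel_measurable M"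
    and fin: "orlicz_ennorm M (\<lambda>x. \<Phi> x + \<phi> x) f < \<infinity>" "orlicz_ennorm M (\<lambda>x. \<Phi> x + \<phi> x) g < \<infinity>"
    and \<tau>: "0 \<le> \<tau>" "\<tau> \<le> 1 / 2" "modular_const * \<tau> powr \<sigma> \<le> 1 / 2"
  defines "nrm \<equiv> orlicz_norm M (\<lambda>x. \<Phi> x + \<phi> x)"
  shows "nrm f + \<tau> * nrm g
      \<le> max (nrm (\<lambda>x. f x + g x)) (nrm (\<lambda>x. f x - g x)) * (1 + 2 * (modular_const * \<tau> powr \<sigma>))"
proof -
  let ?n = "orlicz_ennorm M (\<lambda>x. \<Phi> x + \<phi> x)" and ?A = "{h \<in> borel_measurable M. modular h \<le> 1}"
  define N where "N = max (nrm (\<lambda>x. f x + g x)) (nrm (\<lambda>x. f x - g x))"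
  have real_n: "?n k = ennreal (nrm k)" if "?n k < \<infinity>" for k
    using that by (simp add: nrm_def orlicz_norm_def)
  have n0: "0 \<le> nrm k" for k by (simp add: nrm_def orlicz_norm_def)
  have N0: "0 \<le> N" by (simp add: N_def nrm_def orlicz_norm_def le_max_iff_disj)
  have "?n (\<lambda>x. f x + g x) < \<infinity>" "?n (\<lambda>x. f x - g x) < \<infinity>"
    using fin orlicz_ennorm_add_le[of f M g "\<lambda>x. \<Phi> x + \<phi> x"] by (auto simp: less_top[symmetric] top_unique)
  then have "?n (\<lambda>x. f x + g x) \<le> ennreal N" "?n (\<lambda>x. f x - g x) \<le> ennreal N"
    by (simp_all add: real_n N_def ennreal_leI)
  then have N: "(\<integral>\<^sup>+x. ennreal (cmod ((f x + g x) * h x)) \<partial>M) \<le> ennreal N"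
      "(\<integral>\<^sup>+x. ennreal (cmod ((f x - g x) * h x)) \<partial>M) \<le> ennreal N"
    if "h \<in> borel_measurable M" "modular h \<le> 1" for h
    using that unfolding orlicz_ennorm_eq by (auto simp: SUP_le_iff)
  define R where "R = N * (1 + 2 * (modular_const * \<tau> powr \<sigma>))"
  have pair: "(\<integral>\<^sup>+x. ennreal (cmod (f x * h1 x)) \<partial>M) + ennreal \<tau> * (\<integral>\<^sup>+x. ennreal (cmod (g x * h2 x)) \<partial>M)
      \<le> ennreal R" if "h1 \<in> ?A" "h2 \<in> ?A" for h1 h2
  proof -
    have hm: "h1 \<in> borel_measurable M" "modular h1 \<le> 1" "h2 \<in> borel_measurable M" "modular h2 \<le> 1"
      using that by auto
    obtain k1 where k1: "k1 \<in> borel_measurable M" "modular k1 \<le> 1"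
      "\<And>x. f x * k1 x = complex_of_real (cmod (f x * h1 x))"
      using align_phase[OF assms(1) hm(1,2)] by blast
    obtain k2 where k2: "k2 \<in> borel_measurable M" "modular k2 \<le> 1"
      "\<And>x. g x * k2 x = complex_of_real (cmod (g x * h2 x))"
      using align_phase[OF assms(2) hm(3,4)] by blast
    have modulus: "cmod (f x * k1 x) = cmod (f x * h1 x)" "cmod (g x * k2 x) = cmod (g x * h2 x)" for x
      unfolding k1(3) k2(3) by simp_all
    have "f x * k1 x = complex_of_real (cmod (f x * k1 x))" "g x * k2 x = complex_of_real (cmod (g x * k2 x))" for x
      unfolding modulus by (rule k1(3) k2(3))+
    from aligned_pairing_bound[OF assms(1,2) k1(1) k2(1) k1(2) k2(2) this N0 N \<tau>]
    show ?thesis unfolding modulus R_def .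
  qed
  have ne: "?A \<noteq> {}" using zero_admissible by blast
  have 1: "(\<integral>\<^sup>+x. ennreal (cmod (f x * h1 x)) \<partial>M) + ennreal \<tau> * ?n g \<le> ennreal R" if "h1 \<in> ?A" for h1
    unfolding orlicz_ennorm_eq SUP_mult_left_ennreal
    unfolding ennreal_SUP_add_right[OF ne] using pair[OF that] by (rule SUP_least)
  have "?n f + ennreal \<tau> * ?n g \<le> ennreal R"
    unfolding orlicz_ennorm_eq[of f] ennreal_SUP_add_left[OF ne, symmetric] using 1 by (rule SUP_least)
  then have "ennreal (nrm f + \<tau> * nrm g) \<le> ennreal R"
    using n0 \<tau> by (simp add: real_n[OF fin(1)] real_n[OF fin(2)] ennreal_plus ennreal_mult)
  moreover have "0 \<le> R"
    unfolding R_def using N0 modular_const_nonneg by (intro mult_nonneg_nonneg add_nonneg_nonneg) auto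
  ultimately have "nrm f + \<tau> * nrm g \<le> R"
    by (simp only: ennreal_le_iff)
  then show ?thesis unfolding R_def N_def .
qed

end

text \<open>Legendre duality between the powers \<open>\<sigma>\<close> and \<open>s\<close>: the choice \<open>\<tau> = \<tau>\<^sub>1 (G / N)\<^sup>s\<^sup>-\<^sup>1\<close> makes both \<open>\<tau> G\<close> and
  \<open>N \<tau>\<^sup>\<sigma>\<close> multiples of \<open>N (G / N)\<^sup>s\<close>, and for small \<open>\<tau>\<^sub>1\<close> half of the first one survives. The result
  \<open>F / N + m (G / N)\<^sup>s \<le> 1\<close> is stronger than required because \<open>F \<le> N\<close>.\<close>

lemma power_type_from_linear_family:
  fixes C s \<sigma> \<tau>0 :: real
  assumes s: "1 < s" "1 / s + 1 / \<sigma> = 1" and C: "0 \<le> C" and \<tau>0: "0 < \<tau>0"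
  obtains m where "0 < m"
    "\<And>F G N. \<lbrakk>0 \<le> F; 0 \<le> G; 0 \<le> N; \<And>\<tau>. 0 \<le> \<tau> \<Longrightarrow> \<tau> \<le> \<tau>0 \<Longrightarrow> F + \<tau> * G \<le> N * (1 + C * \<tau> powr \<sigma>)\<rbrakk>
      \<Longrightarrow> (F powr s + m * G powr s) powr (1 / s) \<le> N"
proof -
  have \<sigma>: "\<sigma> = s / (s - 1)" "1 < \<sigma>"
  proof -
    have "1 / \<sigma> = (s - 1) / s" using s by (simp add: field_simps)
    then show "\<sigma> = s / (s - 1)" using s by (metis inverse_divide inverse_eq_divide div_by_1 divide_divide_eq_right mult_1)
    then show "1 < \<sigma>" using s by (simp only: less_divide_eq_1_pos)
  qed
  define b where "b = (1 + C * \<tau>0 powr \<sigma>) / \<tau>0"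
  have b: "0 < b" using C \<tau>0 by (simp add: b_def add_pos_nonneg)
  \<comment> \<open>\<open>b\<close> bounds \<open>G / N\<close>. The first term of the minimum keeps \<open>\<tau> \<le> \<tau>0\<close>, the second one gives
    \<open>C \<tau>1 powr \<sigma> \<le> \<tau>1 / 2\<close>.\<close>
  define \<tau>1 where "\<tau>1 = min (\<tau>0 / b powr (s - 1)) ((1 / (2 * (C + 1))) powr (1 / (\<sigma> - 1)))"
  have \<tau>1: "0 < \<tau>1" using b \<tau>0 C by (simp add: \<tau>1_def)
  have \<tau>1b: "\<tau>1 * b powr (s - 1) \<le> \<tau>0"
  proof -
    have "\<tau>1 \<le> \<tau>0 / b powr (s - 1)" by (simp add: \<tau>1_def)
    then show ?thesis using b by (simp add: pos_le_divide_eq)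
  qed
  have C\<tau>1: "C * \<tau>1 powr \<sigma> \<le> \<tau>1 / 2"
  proof -
    have "\<tau>1 powr (\<sigma> - 1) \<le> ((1 / (2 * (C + 1))) powr (1 / (\<sigma> - 1))) powr (\<sigma> - 1)"
      using \<tau>1 \<sigma> by (intro powr_mono2) (auto simp: \<tau>1_def)
    also have "\<dots> = 1 / (2 * (C + 1))" using \<sigma> C by (simp add: powr_powr)
    finally have "C * \<tau>1 powr (\<sigma> - 1) \<le> C * (1 / (2 * (C + 1)))" using C by (rule mult_left_mono)
    also have "\<dots> \<le> 1 / 2" using C by (simp add: field_simps)
    finally have "(C * \<tau>1 powr (\<sigma> - 1)) * \<tau>1 \<le> 1 / 2 * \<tau>1" using \<tau>1 by (intro mult_right_mono) auto
    moreover have "\<tau>1 powr (\<sigma> - 1) * \<tau>1 = \<tau>1 powr \<sigma>" using \<tau>1 by (simp add: powr_diff)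
    ultimately show ?thesis by (simp add: mult.assoc)
  qed
  show thesis
  proof (rule that[of "\<tau>1 / 2"])
    show "0 < \<tau>1 / 2" using \<tau>1 by simp
  next
    fix F G N :: real
    assume nn: "0 \<le> F" "0 \<le> G" "0 \<le> N"
      and le: "\<And>\<tau>. 0 \<le> \<tau> \<Longrightarrow> \<tau> \<le> \<tau>0 \<Longrightarrow> F + \<tau> * G \<le> N * (1 + C * \<tau> powr \<sigma>)"
    have FN: "F \<le> N" using le[of 0] \<tau>0 by simp
    have GN: "G \<le> N * b"
    proof -
      have "\<tau>0 * G \<le> N * (1 + C * \<tau>0 powr \<sigma>)" using le[of \<tau>0] \<tau>0 nn by linarith
      then show ?thesis using \<tau>0 by (simp add: b_def pos_le_divide_eq mult.commute)
    qed
    show "(F powr s + \<tau>1 / 2 * G powr s) powr (1 / s) \<le> N"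
    proof (cases "N = 0")
      case True
      then have "F = 0" "G = 0" using FN GN nn by auto
      then show ?thesis using True by simp
    next
      case False
      then have N: "0 < N" using nn by simp
      define x where "x = G / N"
      have x: "0 \<le> x" "x \<le> b" "G = x * N" using nn N GN by (auto simp: x_def divide_le_eq mult.commute)
      define \<tau> where "\<tau> = \<tau>1 * x powr (s - 1)"
      have \<tau>: "0 \<le> \<tau>" using \<tau>1 by (simp add: \<tau>_def)
      have "\<tau> \<le> \<tau>1 * b powr (s - 1)"
        unfolding \<tau>_def using x s \<tau>1 by (intro mult_left_mono powr_mono2) auto
      then have "\<tau> \<le> \<tau>0" using \<tau>1b by linarith
      have xs: "x powr (s - 1) * x = x powr s" using x by (cases "x = 0") (auto simp: powr_diff)
      have "(s - 1) * \<sigma> = s" using s \<sigma>(1) by simp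
      then have "\<tau> powr \<sigma> = \<tau>1 powr \<sigma> * x powr s"
        using \<tau>1 by (simp add: \<tau>_def powr_mult powr_powr)
      then have "F + \<tau> * G \<le> N * (1 + C * (\<tau>1 powr \<sigma> * x powr s))"
        using le[OF \<tau> \<open>\<tau> \<le> \<tau>0\<close>] by simp
      also have "\<dots> = N + N * ((C * \<tau>1 powr \<sigma>) * x powr s)" by (simp add: algebra_simps)
      also have "\<dots> \<le> N + N * (\<tau>1 / 2 * x powr s)"
        using C\<tau>1 nn by (intro add_left_mono mult_left_mono mult_right_mono) auto
      finally have "F + \<tau> * G \<le> N + N * (\<tau>1 / 2 * x powr s)" .
      moreover have "\<tau> * G = N * (\<tau>1 * x powr s)"
        by (simp add: \<tau>_def x(3) xs[symmetric] mult_ac)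
      ultimately have key: "F + N * (\<tau>1 / 2 * x powr s) \<le> N" by (simp add: algebra_simps)
      define y where "y = F / N"
      have y: "0 \<le> y" "y \<le> 1" "F = y * N" using nn N FN by (auto simp: y_def)
      have "N * (y + \<tau>1 / 2 * x powr s) \<le> N * 1" using key by (simp add: y(3) algebra_simps)
      then have "y + \<tau>1 / 2 * x powr s \<le> 1" using N by simp
      moreover have "y powr s \<le> y" using powr_mono'[of 1 s y] y s by simp
      ultimately have "y powr s + \<tau>1 / 2 * x powr s \<le> 1" by linarith
      then have "(y powr s + \<tau>1 / 2 * x powr s) * N powr s \<le> 1 * N powr s"
        by (rule mult_right_mono) simp
      then have "F powr s + \<tau>1 / 2 * G powr s \<le> N powr s"
        using x y N by (simp add: x(3) y(3) powr_mult distrib_right)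
      then have "(F powr s + \<tau>1 / 2 * G powr s) powr (1 / s) \<le> (N powr s) powr (1 / s)"
        using s \<tau>1 by (intro powr_mono2) auto
      also have "\<dots> = N" using s N by (simp add: powr_powr)
      finally show ?thesis .
    qed
  qed
qed

section \<open>The power-convex part of a Young function\<close>

text \<open>A concave function vanishing at \<open>0\<close> satisfies \<open>H(\<lambda> u) \<ge> \<lambda> H(u)\<close> for \<open>0 \<le> \<lambda> \<le> 1\<close>; take \<open>\<lambda> = l\<^sup>s\<close>.\<close>

lemma young_power_scale:
  assumes \<Phi>: "young_function \<Phi>" and s: "0 < s"
    and conc: "concave_on {0..} (\<lambda>u. \<Phi> (u powr (1 / s)))"
    and l: "0 \<le> l" "l \<le> 1" and x: "0 \<le> x"
  shows "l powr s * \<Phi> x \<le> \<Phi> (l * x)"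
proof -
  have "l powr s \<le> 1" using l s by (simp add: powr_le1)
  then have "(1 - l powr s) * \<Phi> (0 powr (1 / s)) + l powr s * \<Phi> ((x powr s) powr (1 / s))
      \<le> \<Phi> (((1 - l powr s) *\<^sub>R 0 + l powr s *\<^sub>R x powr s) powr (1 / s))"
    using concave_onD[OF conc, of "l powr s" 0 "x powr s"] by simp
  moreover have "((1 - l powr s) *\<^sub>R 0 + l powr s *\<^sub>R x powr s) powr (1 / s) = l * x"
    using l x s by (simp add: powr_mult powr_powr)
  ultimately show ?thesis using \<Phi> x s by (simp add: young_function_def powr_powr)
qed

text \<open>Iterating \<open>\<Phi>(a x) \<ge> 2 a \<Phi>(x)\<close> along \<open>t, a t, a\<^sup>2 t, \<dots>\<close> gives growth with exponent \<open>log a (2 a) > 1\<close>,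
  and monotonicity fills the gaps at the cost of one factor \<open>2 a\<close>.\<close>

lemma nabla2_power_growth:
  assumes \<Phi>: "young_function \<Phi>" and a: "1 < a" "a powr p \<le> 2 * a" and p: "0 < p"
    and grow: "\<And>x. x0 \<le> x \<Longrightarrow> \<Phi> x \<le> 1 / (2 * a) * \<Phi> (a * x)"
    and t: "x0 \<le> t" "0 < t" "t \<le> x"
  shows "\<Phi> t * (x / t) powr p \<le> 2 * a * \<Phi> x"
proof -
  have iter: "(2 * a) ^ n * \<Phi> t \<le> \<Phi> (a ^ n * t)" for n
  proof (induction n)
    case (Suc n)
    have "x0 \<le> a ^ n * t"
      using t a mult_right_mono[of 1 "a ^ n" t] one_le_power[of a n] by linarith
    have "(2 * a) ^ Suc n * \<Phi> t = 2 * a * ((2 * a) ^ n * \<Phi> t)" by simp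
    also have "\<dots> \<le> 2 * a * \<Phi> (a ^ n * t)" using Suc a by (intro mult_left_mono) auto
    also have "\<dots> \<le> \<Phi> (a ^ Suc n * t)"
      using grow[OF \<open>x0 \<le> a ^ n * t\<close>] a by (simp add: field_simps)
    finally show ?case .
  qed simp
  have \<Phi>t: "0 \<le> \<Phi> t" "\<And>u v. 0 \<le> u \<Longrightarrow> u \<le> v \<Longrightarrow> \<Phi> u \<le> \<Phi> v"
    using \<Phi> t by (auto intro: young_nonneg young_mono)
  define n where "n = nat \<lfloor>log a (x / t)\<rfloor>"
  have lg: "0 \<le> log a (x / t)" using a t by (simp add: zero_le_log_cancel_iff)
  have n: "real n \<le> log a (x / t)" "log a (x / t) \<le> real (Suc n)"
    using lg unfolding n_def by linarith+
  have "a ^ n \<le> x / t" using n(1) a t by (simp add: le_log_iff powr_realpow)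
  then have low: "a ^ n * t \<le> x" using t by (simp add: field_simps)
  have "x / t \<le> a powr real (Suc n)" using n(2) a t by (simp add: log_le_iff del: of_nat_Suc)
  then have "x / t \<le> a ^ Suc n" using a by (simp only: powr_realpow)
  then have "(x / t) powr p \<le> (a ^ Suc n) powr p" using t p by (intro powr_mono2) auto
  also have "\<dots> = (a powr p) ^ Suc n"
    using a by (simp add: powr_power[symmetric] mult.commute del: power_Suc flip: powr_realpow) (simp add: powr_powr mult.commute)
  also have "\<dots> \<le> (2 * a) ^ Suc n" using a by (intro power_mono) auto
  finally have "\<Phi> t * (x / t) powr p \<le> \<Phi> t * (2 * a) ^ Suc n"
    using \<Phi>t by (intro mult_left_mono)
  also have "\<dots> = 2 * a * ((2 * a) ^ n * \<Phi> t)" by simp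
  also have "\<dots> \<le> 2 * a * \<Phi> (a ^ n * t)" using iter[of n] a by (intro mult_left_mono) auto
  also have "\<dots> \<le> 2 * a * \<Phi> x" using low a t by (intro mult_left_mono \<Phi>t) auto
  finally show ?thesis .
qed

text \<open>As a supremum of affine functions of \<open>x\<^sup>p\<close> this is a convex function of \<open>x\<^sup>p\<close>. The term for \<open>t\<close> is the
  line through \<open>0\<close> and \<open>\<theta>(t)\<close> in the variable \<open>x\<^sup>p\<close>, shifted to vanish at \<open>t\<close>. For \<open>\<theta>(0) = 0\<close> the
  term \<open>t = 0\<close> contributes \<open>0\<close>, which makes the supremum nonnegative.\<close>

definition power_hull :: "real \<Rightarrow> (real \<Rightarrow> real) \<Rightarrow> real \<Rightarrow> real" where
  "power_hull p \<theta> x = (SUP t\<in>{0..}. \<theta> t * ((x / t) powr p - 1))"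

lemma superlinear_powr:
  assumes "1 < p" "0 < k"
  shows "superlinear (\<lambda>x. k * (x powr p - 1))"
  unfolding superlinear_def
proof
  fix y
  define X where "X = (\<bar>y\<bar> / k) powr (1 / (p - 1))"
  have "x * y - k * (x powr p - 1) \<le> X * \<bar>y\<bar> + k" if x: "0 \<le> x" for x
  proof (cases "x \<le> X")
    case True
    have "x * y \<le> x * \<bar>y\<bar>" using x by (intro mult_left_mono) auto
    also have "\<dots> \<le> X * \<bar>y\<bar>" using True by (intro mult_right_mono) auto
    finally have "x * y \<le> X * \<bar>y\<bar>" .
    moreover have "0 \<le> k * x powr p" using assms by simp
    ultimately show ?thesis by (simp add: right_diff_distrib)
  next
    case False
    have X0: "0 \<le> X" by (simp add: X_def)
    then have "0 < x" using False by simp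
    have "\<bar>y\<bar> / k = X powr (p - 1)" using assms by (simp add: X_def powr_powr)
    also have "\<dots> \<le> x powr (p - 1)" using False X0 assms by (intro powr_mono2) auto
    finally have "\<bar>y\<bar> \<le> k * x powr (p - 1)" using assms by (simp add: field_simps)
    then have "x * \<bar>y\<bar> \<le> x * (k * x powr (p - 1))" using x by (rule mult_left_mono)
    also have "\<dots> = k * x powr p" using \<open>0 < x\<close> by (simp add: powr_diff)
    finally have "x * \<bar>y\<bar> \<le> k * x powr p" .
    moreover have "x * y \<le> x * \<bar>y\<bar>" using x by (intro mult_left_mono) auto
    moreover have "0 \<le> X * \<bar>y\<bar>" using X0 by simp
    ultimately show ?thesis by (simp add: right_diff_distrib)
  qed
  then show "bdd_above ((\<lambda>x. x * y - k * (x powr p - 1)) ` {0..})"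
    by (auto simp: bdd_above_def)
qed

text \<open>Each term of the hull is at most \<open>\<theta>(t) (x / t)\<^sup>p\<close> if \<open>t \<le> x\<close>, and nonpositive otherwise, so the growth of \<open>\<Phi>\<close>
  bounds the hull; the term with \<open>(x / t)\<^sup>p = 2\<close> bounds it from below by \<open>\<theta>\<close>. The scaling of \<open>\<theta>\<close> is
  inherited because dilating \<open>x\<close> and \<open>t\<close> simultaneously leaves \<open>x / t\<close> unchanged.\<close>

lemma power_hull_properties:
  fixes \<theta> \<Phi> :: "real \<Rightarrow> real" and p s C :: real
  assumes p: "1 < p" and s: "2 \<le> s"
    and \<theta>: "\<theta> 0 = 0" "\<And>t. 0 \<le> t \<Longrightarrow> 0 \<le> \<theta> t" "0 < \<theta> 1"
    and C: "\<And>x. 0 \<le> x \<Longrightarrow> 0 \<le> C * \<Phi> x"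
    and growth: "\<And>t x. 0 < t \<Longrightarrow> t \<le> x \<Longrightarrow> \<theta> t * (x / t) powr p \<le> C * \<Phi> x"
    and scale: "\<And>l t. 0 < l \<Longrightarrow> l \<le> 1 \<Longrightarrow> 0 \<le> t \<Longrightarrow> l powr s * \<theta> t \<le> \<theta> (l * t)"
  shows "power_type (power_hull p \<theta>) p (p / (p - 1)) s (s / (s - 1))"
    and "\<And>x. 0 \<le> x \<Longrightarrow> power_hull p \<theta> x \<le> C * \<Phi> x"
    and "\<And>x. 0 \<le> x \<Longrightarrow> \<theta> x \<le> 2 powr (s / p) * power_hull p \<theta> x"
proof -
  let ?\<phi> = "power_hull p \<theta>"
  have term_le: "\<theta> t * ((x / t) powr p - 1) \<le> C * \<Phi> x" if "0 \<le> x" "0 \<le> t" for x t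
  proof -
    consider "t = 0" | "0 < t" "t \<le> x" | "0 < t" "x < t" using \<open>0 \<le> t\<close> by linarith
    then show ?thesis
    proof cases
      case 1
      then show ?thesis using C that by (simp add: \<theta>)
    next
      case 2
      then show ?thesis using growth[of t x] \<theta>(2)[of t] by (simp add: right_diff_distrib)
    next
      case 3
      then have "(x / t) powr p \<le> 1" using that p by (intro powr_le1) auto
      then have "\<theta> t * ((x / t) powr p - 1) \<le> 0"
        using \<theta>(2)[of t] that by (intro mult_nonneg_nonpos) auto
      also have "0 \<le> C * \<Phi> x" using C that by simp
      finally show ?thesis .
    qed
  qed
  have bdd: "bdd_above ((\<lambda>t. \<theta> t * ((x / t) powr p - 1)) ` {0..})" if "0 \<le> x" for x
    using term_le[OF that] by (auto simp: bdd_above_def)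
  have upper: "\<theta> t * ((x / t) powr p - 1) \<le> ?\<phi> x" if "0 \<le> x" "0 \<le> t" for x t
    unfolding power_hull_def using that by (intro cSUP_upper bdd) auto
  have least: "?\<phi> x \<le> U" if "\<And>t. 0 < t \<Longrightarrow> \<theta> t * ((x / t) powr p - 1) \<le> U" "0 \<le> U" for x U
    unfolding power_hull_def
  proof (rule cSUP_least)
    fix t :: real assume "t \<in> {0..}"
    then show "\<theta> t * ((x / t) powr p - 1) \<le> U"
      using that by (cases "t = 0") (auto simp: \<theta>)
  qed simp
  have nonneg: "0 \<le> ?\<phi> x" if "0 \<le> x" for x
    using upper[OF that, of 0] by (simp add: \<theta>)
  show dom: "?\<phi> x \<le> C * \<Phi> x" if "0 \<le> x" for x
    using term_le C that by (intro least) auto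
  show "\<theta> x \<le> 2 powr (s / p) * ?\<phi> x" if x: "0 \<le> x" for x
  proof (cases "x = 0")
    case True
    then show ?thesis using nonneg[of 0] by (simp add: \<theta>)
  next
    case False
    define l where "l = (1 / 2 :: real) powr (1 / p)"
    have l: "0 < l" "l \<le> 1" using p by (auto simp: l_def powr_le1)
    have "x / (l * x) = 2 powr (1 / p)"
      using False by (simp add: l_def powr_divide)
    then have "(x / (l * x)) powr p = 2" using p by (simp add: powr_powr)
    then have "\<theta> (l * x) \<le> ?\<phi> x" using upper[of x "l * x"] l x by simp
    then have "l powr s * \<theta> x \<le> ?\<phi> x" using scale[OF l x] by linarith
    then have "2 powr (s / p) * (l powr s * \<theta> x) \<le> 2 powr (s / p) * ?\<phi> x"
      by (rule mult_left_mono) simp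
    moreover have "2 powr (s / p) * l powr s = 1"
      by (simp add: l_def powr_powr powr_divide)
    ultimately show ?thesis by (simp flip: mult.assoc)
  qed
  show "power_type ?\<phi> p (p / (p - 1)) s (s / (s - 1))"
  proof
    show "1 < p" "1 < s" using p s by auto
    show "1 / p + 1 / (p / (p - 1)) = 1" "1 / s + 1 / (s / (s - 1)) = 1"
      using p s by (simp_all flip: add_divide_distrib)
    show "s / (s - 1) \<le> 2" using s by (simp add: divide_le_eq)
    show "?\<phi> 0 = 0"
      using nonneg[of 0] \<theta>(2) by (intro antisym least) auto
    show "superlinear ?\<phi>"
    proof (rule superlinear_mono[OF superlinear_powr[OF p \<theta>(3)]])
      fix x :: real assume "0 \<le> x"
      then show "\<theta> 1 * (x powr p - 1) \<le> ?\<phi> x" using upper[of x 1] by simp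
    qed
    show "l powr s * ?\<phi> x \<le> ?\<phi> (l * x)" if l: "0 \<le> l" "l \<le> 1" and x: "0 \<le> x" for l x
    proof (cases "l = 0")
      case True
      then show ?thesis using nonneg[of 0] by simp
    next
      case False
      then have l0: "0 < l" using l by simp
      have "?\<phi> x \<le> ?\<phi> (l * x) / l powr s"
      proof (rule least)
        fix t :: real assume t: "0 < t"
        show "\<theta> t * ((x / t) powr p - 1) \<le> ?\<phi> (l * x) / l powr s"
        proof (cases "1 \<le> (x / t) powr p")
          case True
          have "l powr s * \<theta> t * ((x / t) powr p - 1) \<le> \<theta> (l * t) * ((x / t) powr p - 1)"
            using scale[OF l0 l(2), of t] t True by (intro mult_right_mono) auto
          also have "\<dots> = \<theta> (l * t) * (((l * x) / (l * t)) powr p - 1)"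
            using l0 by simp
          also have "\<dots> \<le> ?\<phi> (l * x)" using l x t by (intro upper) auto
          finally show ?thesis using l0 by (simp add: field_simps)
        next
          case False
          then have "\<theta> t * ((x / t) powr p - 1) \<le> 0"
            using \<theta>(2)[of t] t by (intro mult_nonneg_nonpos) auto
          also have "0 \<le> ?\<phi> (l * x) / l powr s" using nonneg[of "l * x"] l x by simp
          finally show ?thesis .
        qed
      qed (use nonneg[of "l * x"] l x in simp)
      then show ?thesis using l0 by (simp add: field_simps)
    qed
    show "?\<phi> z \<le> l * ?\<phi> x + m * ?\<phi> y"
      if h: "0 \<le> x" "0 \<le> y" "0 \<le> z" "0 \<le> l" "0 \<le> m" "l + m = 1"
        "z powr p \<le> l * x powr p + m * y powr p" for x y z l m
    proof (rule least)
      fix t :: real assume t: "0 < t"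
      have "(z / t) powr p \<le> (l * x powr p + m * y powr p) / t powr p"
        using h t by (simp add: powr_divide divide_right_mono)
      also have "\<dots> = l * (x / t) powr p + m * (y / t) powr p"
        using h t by (simp add: powr_divide add_divide_distrib)
      finally have "(z / t) powr p - 1 \<le> l * ((x / t) powr p - 1) + m * ((y / t) powr p - 1)"
        using h(6) by (simp add: algebra_simps)
      then have "\<theta> t * ((z / t) powr p - 1) \<le> \<theta> t * (l * ((x / t) powr p - 1) + m * ((y / t) powr p - 1))"
        using \<theta>(2)[of t] t by (intro mult_left_mono) auto
      also have "\<dots> = l * (\<theta> t * ((x / t) powr p - 1)) + m * (\<theta> t * ((y / t) powr p - 1))"
        by (simp add: algebra_simps)
      also have "\<dots> \<le> l * ?\<phi> x + m * ?\<phi> y"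
        using h t by (intro add_mono mult_left_mono upper) auto
      finally show "\<theta> t * ((z / t) powr p - 1) \<le> l * ?\<phi> x + m * ?\<phi> y" .
    qed (use nonneg h in simp)
  qed
qed

text \<open>Below \<open>x\<^sub>0\<close>, where no power growth of \<open>\<Phi>\<close> is available, \<open>\<Phi>\<close> is replaced by a multiple of \<open>t\<^sup>s\<close>: this is the
  smallest continuation compatible with the scaling property, hence at most \<open>\<Phi>\<close>, and it grows at
  least like the power \<open>p\<close>. For \<open>x\<^sub>0 = 0\<close> nothing changes on \<open>[0,\<infinity>)\<close>.\<close>

definition power_extension :: "real \<Rightarrow> real \<Rightarrow> (real \<Rightarrow> real) \<Rightarrow> real \<Rightarrow> real" where
  "power_extension s x0 \<Phi> t = (if x0 \<le> t then \<Phi> t else \<Phi> x0 * (t / x0) powr s)"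

lemma power_extension_properties:
  fixes \<Phi> :: "real \<Rightarrow> real" and s x0 :: real
  assumes \<Phi>: "young_function \<Phi>" and s: "0 < s" and x0: "0 \<le> x0"
    and scale_all: "\<forall>l\<in>{0..1}. \<forall>x\<ge>0. l powr s * \<Phi> x \<le> \<Phi> (l * x)"
  defines "\<theta> \<equiv> power_extension s x0 \<Phi>"
  shows "\<theta> 0 = 0"
    and "\<And>t. 0 \<le> t \<Longrightarrow> 0 \<le> \<theta> t"
    and "\<And>t. 0 \<le> t \<Longrightarrow> \<theta> t \<le> \<Phi> t"
    and "\<And>t. 0 \<le> t \<Longrightarrow> \<Phi> t \<le> \<theta> t + \<Phi> x0"
    and "\<And>l t. 0 < l \<Longrightarrow> l \<le> 1 \<Longrightarrow> 0 \<le> t \<Longrightarrow> l powr s * \<theta> t \<le> \<theta> (l * t)"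
    and "\<And>C p t x. \<lbrakk>1 \<le> C; p \<le> s; \<And>t x. x0 \<le> t \<Longrightarrow> 0 < t \<Longrightarrow> t \<le> x \<Longrightarrow> \<Phi> t * (x / t) powr p \<le> C * \<Phi> x;
        0 < t; t \<le> x\<rbrakk> \<Longrightarrow> \<theta> t * (x / t) powr p \<le> C * \<Phi> x"
proof -
  have scale: "l powr s * \<Phi> x \<le> \<Phi> (l * x)" if "0 \<le> l" "l \<le> 1" "0 \<le> x" for l x
    using scale_all that by simp
  have mono: "\<Phi> u \<le> \<Phi> v" if "0 \<le> u" "u \<le> v" for u v
    by (rule young_mono[OF \<Phi> that])
  have \<Phi>0: "\<Phi> 0 = 0" using \<Phi> by (simp add: young_function_def)
  have nn: "0 \<le> \<Phi> u" if "0 \<le> u" for u by (rule young_nonneg[OF \<Phi> that])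
  show "\<theta> 0 = 0" using x0 s \<Phi>0 by (simp add: \<theta>_def power_extension_def)
  show "0 \<le> \<theta> t" if "0 \<le> t" for t using nn x0 that by (simp add: \<theta>_def power_extension_def)
  show le: "\<theta> t \<le> \<Phi> t" if "0 \<le> t" for t
  proof (cases "x0 \<le> t")
    case False
    then show ?thesis using scale[of "t / x0" x0] that x0 s
      by (simp add: \<theta>_def power_extension_def mult.commute)
  qed (simp add: \<theta>_def power_extension_def)
  show "\<Phi> t \<le> \<theta> t + \<Phi> x0" if "0 \<le> t" for t
    using mono[of t x0] nn[of x0] that x0 by (auto simp: \<theta>_def power_extension_def add_increasing)
  show "l powr s * \<theta> t \<le> \<theta> (l * t)" if l: "0 < l" "l \<le> 1" and t: "0 \<le> t" for l t
  proof -
    have lt: "l * t \<le> t" using l t by (intro mult_left_le_one_le) auto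
    consider "x0 \<le> l * t" | "l * t < x0" "x0 \<le> t" | "t < x0" using lt by linarith
    then show ?thesis
    proof cases
      case 1
      then show ?thesis using scale[of l t] l t lt by (simp add: \<theta>_def power_extension_def)
    next
      case 2
      have "0 \<le> l * t" using l t by simp
      then have pos: "0 < x0" "0 < t" using 2 by linarith+
      have "(x0 / t) powr s * \<Phi> t \<le> \<Phi> x0"
        using scale[of "x0 / t" t] pos 2 by simp
      then have "(l * t / x0) powr s * ((x0 / t) powr s * \<Phi> t) \<le> (l * t / x0) powr s * \<Phi> x0"
        by (rule mult_left_mono) simp
      moreover have "(l * t / x0) powr s * (x0 / t) powr s = l powr s"
        using pos l by (simp flip: powr_mult)
      ultimately have "l powr s * \<Phi> t \<le> \<Phi> x0 * (l * t / x0) powr s"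
        by (simp only: mult.assoc[symmetric] mult.commute[of "\<Phi> x0"])
      then show ?thesis using 2 by (simp add: \<theta>_def power_extension_def)
    next
      case 3
      have "(l * t / x0) powr s = l powr s * (t / x0) powr s"
        using l t 3 by (simp add: powr_mult powr_divide)
      then show ?thesis using 3 lt
        by (simp add: \<theta>_def power_extension_def)
    qed
  qed
  show "\<theta> t * (x / t) powr p \<le> C * \<Phi> x"
    if C: "1 \<le> C" and ps: "p \<le> s" and t: "0 < t" "t \<le> x"
      and grow: "\<And>t x. x0 \<le> t \<Longrightarrow> 0 < t \<Longrightarrow> t \<le> x \<Longrightarrow> \<Phi> t * (x / t) powr p \<le> C * \<Phi> x" for C p t x
  proof (cases "x0 \<le> t")
    case True
    then show ?thesis using grow[OF True t] by (simp add: \<theta>_def power_extension_def)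
  next
    case False
    then have pos: "0 < x0" "0 < x" using t by auto
    have \<theta>t: "\<theta> t = \<Phi> x0 * (t / x0) powr s" using False by (simp add: \<theta>_def power_extension_def)
    show ?thesis
    proof (cases "x0 \<le> x")
      case True
      have "(t / x0) powr s \<le> (t / x0) powr p"
        using False t ps pos by (intro powr_mono') auto
      then have "\<Phi> x0 * (t / x0) powr s * (x / t) powr p \<le> \<Phi> x0 * (t / x0) powr p * (x / t) powr p"
        using nn[of x0] pos by (intro mult_right_mono mult_left_mono) auto
      also have "\<dots> = \<Phi> x0 * (x / x0) powr p"
        using t pos by (simp add: powr_divide)
      also have "\<dots> \<le> C * \<Phi> x" using grow[of x0 x] pos True by simp
      finally show ?thesis by (simp add: \<theta>t)
    next
      case False
      have "(x / t) powr p \<le> (x / t) powr s" using t ps by (intro powr_mono) auto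
      then have "\<Phi> x0 * (t / x0) powr s * (x / t) powr p \<le> \<Phi> x0 * (t / x0) powr s * (x / t) powr s"
        using nn[of x0] pos by (intro mult_left_mono) auto
      also have "\<dots> = (x / x0) powr s * \<Phi> x0"
        using t pos by (simp add: powr_divide)
      also have "\<dots> \<le> \<Phi> x" using scale[of "x / x0" x0] pos False by simp
      also have "\<dots> \<le> C * \<Phi> x" using C nn[of x] pos mult_right_mono[of 1 C "\<Phi> x"] by simp
      finally show ?thesis by (simp add: \<theta>t)
    qed
  qed
qed

text \<open>Here the complementary function is infinite on \<open>(0,\<infinity>)\<close>, so admissible test functions vanish almost
  everywhere.\<close>

lemma orlicz_norm_of_zero_function:
  assumes \<Phi>: "\<And>x. 0 \<le> x \<Longrightarrow> \<Phi> x = 0" and [measurable]: "f \<in> borel_measurable M"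
  shows "orlicz_norm M \<Phi> f = 0"
proof -
  have top: "complementary \<Phi> y = \<infinity>" if y: "0 < y" for y
  proof (rule ccontr)
    assume "complementary \<Phi> y \<noteq> \<infinity>"
    then obtain B where B: "complementary \<Phi> y = ennreal B" "0 \<le> B"
      by (cases "complementary \<Phi> y") auto
    have "ennreal ((B + 1) / y * y - \<Phi> ((B + 1) / y)) \<le> complementary \<Phi> y"
      unfolding complementary_def using B y by (intro SUP_upper) auto
    then show False using B y \<Phi>[of "(B + 1) / y"] by simp
  qed
  have "(\<integral>\<^sup>+x. ennreal (cmod (f x * g x)) \<partial>M) = 0"
    if [measurable]: "g \<in> borel_measurable M" and g: "(\<integral>\<^sup>+x. complementary \<Phi> (cmod (g x)) \<partial>M) \<le> 1" for g
  proof -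
    have "\<infinity> * (\<integral>\<^sup>+x. ennreal (cmod (f x * g x)) \<partial>M) = (\<integral>\<^sup>+x. \<infinity> * ennreal (cmod (f x * g x)) \<partial>M)"
      by (rule nn_integral_cmult[symmetric]) measurable
    also have "\<dots> \<le> (\<integral>\<^sup>+x. complementary \<Phi> (cmod (g x)) \<partial>M)"
    proof (rule nn_integral_mono)
      fix x
      show "\<infinity> * ennreal (cmod (f x * g x)) \<le> complementary \<Phi> (cmod (g x))"
        using top[of "cmod (g x)"] by (cases "g x = 0") auto
    qed
    finally have "\<infinity> * (\<integral>\<^sup>+x. ennreal (cmod (f x * g x)) \<partial>M) \<le> 1" using g by (rule order_trans)
    then show ?thesis by (auto simp: ennreal_top_mult top_unique split: if_splits)
  qed
  then have "orlicz_ennorm M \<Phi> f \<le> 0"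
    unfolding orlicz_ennorm_def by (intro SUP_least) auto
  then show ?thesis by (simp add: orlicz_norm_def)
qed

theorem lemma3p7:
  fixes M :: "'a measure" and \<Phi> :: "real \<Rightarrow> real" and s :: real
  assumes "2 \<le> s"
    and "young_function \<Phi>"
    and "nabla2 M \<Phi>"
    and "concave_on {0..} (\<lambda>u. \<Phi> (u powr (1 / s)))"
  shows "\<exists>A>0. \<exists>m>0. \<exists>\<Phi>'. young_function \<Phi>' \<and>
    (\<forall>u\<ge>0. inverse A * \<Phi> u \<le> \<Phi>' u \<and> \<Phi>' u \<le> A * \<Phi> u) \<and>
    (\<forall>f\<in>orlicz_class M \<Phi>. \<forall>g\<in>orlicz_class M \<Phi>.
      max (orlicz_norm M \<Phi>' (\<lambda>x. f x + g x)) (orlicz_norm M \<Phi>' (\<lambda>x. f x - g x))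
        \<ge> (orlicz_norm M \<Phi>' f powr s + m * orlicz_norm M \<Phi>' g powr s) powr (1 / s))"
proof -
  have mono: "\<Phi> u \<le> \<Phi> v" if "0 \<le> u" "u \<le> v" for u v
    by (rule young_mono[OF assms(2) that])
  have \<Phi>0: "\<Phi> 0 = 0" using assms(2) by (simp add: young_function_def)
  have nn: "0 \<le> \<Phi> u" if "0 \<le> u" for u by (rule young_nonneg[OF assms(2) that])
  have s: "0 < s" using assms(1) by simp
  have scale: "l powr s * \<Phi> x \<le> \<Phi> (l * x)" if "0 \<le> l" "l \<le> 1" "0 \<le> x" for l x
    by (rule young_power_scale[OF assms(2) s assms(4) that])
  show ?thesis
  proof (cases "\<forall>x\<ge>0. \<Phi> x = 0")
    case True
    have norm0: "orlicz_norm M \<Phi> h = 0" if "h \<in> borel_measurable M" for h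
      using True that by (intro orlicz_norm_of_zero_function) auto
    show ?thesis
    proof (intro exI[of _ 1] conjI exI[of _ \<Phi>] ballI)
      fix f g assume "f \<in> orlicz_class M \<Phi>" "g \<in> orlicz_class M \<Phi>"
      then have [measurable]: "f \<in> borel_measurable M" "g \<in> borel_measurable M"
        by (auto simp: orlicz_class_def)
      show "max (orlicz_norm M \<Phi> (\<lambda>x. f x + g x)) (orlicz_norm M \<Phi> (\<lambda>x. f x - g x))
        \<ge> (orlicz_norm M \<Phi> f powr s + 1 * orlicz_norm M \<Phi> g powr s) powr (1 / s)"
        by (simp add: norm0)
    qed (use assms(2) in auto)
  next
    case False
    then obtain u where u: "0 \<le> u" "\<Phi> u \<noteq> 0" by blast
    have pos: "0 < \<Phi> t" if "0 < t" for t
    proof (cases "u \<le> t")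
      case True
      then show ?thesis using mono[OF u(1) True] nn[OF u(1)] u(2) by linarith
    next
      case False
      then have "0 < (t / u) powr s * \<Phi> u" using that u nn[of u] by simp
      also have "\<dots> \<le> \<Phi> t" using scale[of "t / u" u] that False by simp
      finally show ?thesis .
    qed
    obtain a x0 where a: "1 < a" and x0: "0 \<le> x0" "emeasure M (space M) = \<infinity> \<longrightarrow> x0 = 0"
      and grow: "\<And>x. x0 \<le> x \<Longrightarrow> \<Phi> x \<le> 1 / (2 * a) * \<Phi> (a * x)"
      using assms(3) unfolding nabla2_def by blast
    \<comment> \<open>\<open>a powr (1 + log a 2) = 2 a\<close>; the bound \<open>2\<close> ensures \<open>p \<le> s\<close>.\<close>
    define p where "p = min 2 (1 + log a 2)"
    have p: "1 < p" "p \<le> s" using a assms(1) by (auto simp: p_def)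
    have ap: "a powr p \<le> 2 * a"
    proof -
      have "a powr p \<le> a powr (1 + log a 2)" using a by (intro powr_mono) (auto simp: p_def)
      also have "\<dots> = 2 * a" using a by (simp add: powr_add)
      finally show ?thesis .
    qed
    \<comment> \<open>\<open>\<theta>\<close> agrees with \<open>\<Phi>\<close> beyond \<open>x0\<close> and differs from it by at most \<open>\<Phi> x0\<close> everywhere. The constant
      \<open>\<Phi> x0\<close> is integrable because either the measure is finite or \<open>x0 = 0\<close>.\<close>
    define \<theta> where "\<theta> = power_extension s x0 \<Phi>"
    have "\<forall>l\<in>{0..1}. \<forall>x\<ge>0. l powr s * \<Phi> x \<le> \<Phi> (l * x)" using scale by simp
    note \<theta> = power_extension_properties[OF assms(2) s x0(1) this, folded \<theta>_def]
    have \<Phi>_growth: "\<Phi> t * (x / t) powr p \<le> 2 * a * \<Phi> x" if "x0 \<le> t" "0 < t" "t \<le> x" for t x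
      by (rule nabla2_power_growth[OF assms(2) a ap _ grow that]) (use p in simp_all)
    have \<theta>_growth: "\<theta> t * (x / t) powr p \<le> 2 * a * \<Phi> x" if "0 < t" "t \<le> x" for t x
      using a p \<Phi>_growth that by (intro \<theta>(6)) auto
    have \<theta>1: "0 < \<theta> 1"
      using pos[of 1] pos[of x0] by (auto simp: \<theta>_def power_extension_def)
    define \<phi> where "\<phi> = power_hull p \<theta>"
    have \<phi>: "power_type \<phi> p (p / (p - 1)) s (s / (s - 1))"
      "\<And>x. 0 \<le> x \<Longrightarrow> \<phi> x \<le> 2 * a * \<Phi> x"
      "\<And>x. 0 \<le> x \<Longrightarrow> \<theta> x \<le> 2 powr (s / p) * \<phi> x"
      unfolding \<phi>_def
      by (rule power_hull_properties[where C = "2 * a" and \<Phi> = \<Phi>, OF p(1) assms(1) \<theta>(1,2) \<theta>1 _ \<theta>_growth \<theta>(5)];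
          use a nn in simp)+
    define \<kappa> where "\<kappa> = enn2real (\<integral>\<^sup>+x. ennreal (\<Phi> x0) \<partial>M)"
    have "(\<integral>\<^sup>+x. ennreal (\<Phi> x0) \<partial>M) < \<infinity>"
      using x0 \<Phi>0 by (cases "emeasure M (space M) = \<infinity>") (auto simp: ennreal_mult_less_top less_top)
    then have \<kappa>: "0 \<le> \<kappa>" "(\<integral>\<^sup>+x. ennreal (\<Phi> x0) \<partial>M) \<le> ennreal \<kappa>"
      by (auto simp: \<kappa>_def)
    interpret perturbed \<phi> p "p / (p - 1)" s "s / (s - 1)" \<Phi> M "2 powr (s / p) + 1" "\<Phi> x0" \<kappa>
    proof (intro perturbed.intro perturbed_axioms.intro \<phi>(1))
      show "\<Phi> x + \<phi> x \<le> (2 powr (s / p) + 1) * \<phi> x + \<Phi> x0" if "0 \<le> x" for x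
        using \<theta>(4)[OF that] \<phi>(3)[OF that] by (simp add: distrib_right)
    qed (use assms(2) \<kappa> nn x0 in auto)
    let ?\<Phi>' = "\<lambda>x. \<Phi> x + \<phi> x"
    have young': "young_function ?\<Phi>'"
      using assms(2) young unfolding young_function_def
      by (auto intro!: convex_on_add mono_onI add_mono dest: mono_onD)
    define c where "c = modular_const"
    have c: "0 \<le> c" using modular_const_nonneg by (simp add: c_def)
    define \<tau>0 where "\<tau>0 = min (1 / 2) ((1 / (2 * (c + 1))) powr (1 / (s / (s - 1))))"
    have \<tau>0: "0 < \<tau>0" "\<tau>0 \<le> 1 / 2" using c by (auto simp: \<tau>0_def)
    have small: "c * \<tau> powr (s / (s - 1)) \<le> 1 / 2" if "0 \<le> \<tau>" "\<tau> \<le> \<tau>0" for \<tau>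
    proof -
      have "\<tau> powr (s / (s - 1)) \<le> ((1 / (2 * (c + 1))) powr (1 / (s / (s - 1)))) powr (s / (s - 1))"
        using that \<sigma>_gt_1 by (intro powr_mono2) (auto simp: \<tau>0_def)
      also have "\<dots> = 1 / (2 * (c + 1))" unfolding powr_powr using assms(1) c by simp
      finally have "c * \<tau> powr (s / (s - 1)) \<le> c * (1 / (2 * (c + 1)))" using c by (rule mult_left_mono)
      also have "\<dots> \<le> 1 / 2" using c by (simp add: field_simps)
      finally show ?thesis .
    qed
    have s1: "1 < s" "0 \<le> 2 * c" using assms(1) c by auto
    obtain m where m: "0 < m"
      "\<And>F G N. \<lbrakk>0 \<le> F; 0 \<le> G; 0 \<le> N; \<And>\<tau>. 0 \<le> \<tau> \<Longrightarrow> \<tau> \<le> \<tau>0 \<Longrightarrow> F + \<tau> * G \<le> N * (1 + 2 * c * \<tau> powr (s / (s - 1)))\<rbrakk>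
        \<Longrightarrow> (F powr s + m * G powr s) powr (1 / s) \<le> N"
      using power_type_from_linear_family[OF s1(1) exponents(4) s1(2) \<tau>0(1)] by blast
    show ?thesis
    proof (rule exI[of _ "1 + 2 * a"], intro conjI exI[of _ m] exI[of _ ?\<Phi>'] ballI allI impI)
      show "0 < 1 + 2 * a" using a by simp
      show "0 < m" by fact
      show "young_function ?\<Phi>'" by fact
      fix u :: real assume u: "0 \<le> u"
      have "inverse (1 + 2 * a) * \<Phi> u \<le> 1 * \<Phi> u"
        using a nn[OF u] by (intro mult_right_mono) (auto simp: inverse_le_1_iff)
      then show "inverse (1 + 2 * a) * \<Phi> u \<le> ?\<Phi>' u" using nonneg[OF u] by simp
      show "?\<Phi>' u \<le> (1 + 2 * a) * \<Phi> u" using \<phi>(2)[OF u] by (simp add: distrib_right)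
    next
      fix f g assume fg: "f \<in> orlicz_class M \<Phi>" "g \<in> orlicz_class M \<Phi>"
      have meas: "f \<in> borel_measurable M" "g \<in> borel_measurable M"
        using fg by (auto simp: orlicz_class_def)
      have fin: "orlicz_ennorm M ?\<Phi>' h < \<infinity>" if "h \<in> orlicz_class M \<Phi>" for h
      proof (rule orlicz_ennorm_finite[OF assms(2) young' _ _ that])
        show "?\<Phi>' u \<le> (1 + 2 * a) * \<Phi> u" if "0 \<le> u" for u
          using \<phi>(2)[OF that] by (simp add: distrib_right)
        show "0 \<le> 1 + 2 * a" using a by simp
      qed
      show "max (orlicz_norm M ?\<Phi>' (\<lambda>x. f x + g x)) (orlicz_norm M ?\<Phi>' (\<lambda>x. f x - g x))
        \<ge> (orlicz_norm M ?\<Phi>' f powr s + m * orlicz_norm M ?\<Phi>' g powr s) powr (1 / s)"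
      proof (rule m(2))
        fix \<tau> :: real assume \<tau>: "0 \<le> \<tau>" "\<tau> \<le> \<tau>0"
        then show "orlicz_norm M ?\<Phi>' f + \<tau> * orlicz_norm M ?\<Phi>' g
          \<le> max (orlicz_norm M ?\<Phi>' (\<lambda>x. f x + g x)) (orlicz_norm M ?\<Phi>' (\<lambda>x. f x - g x))
            * (1 + 2 * c * \<tau> powr (s / (s - 1)))"
          using weak_norm_inequality[OF meas fin[OF fg(1)] fin[OF fg(2)] \<tau>(1)] small[OF \<tau>] \<tau>0 unfolding c_def by (simp add: mult.assoc)
      qed (simp_all add: orlicz_norm_def le_max_iff_disj)
    qed
  qed
qed

end
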